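(* Let $G=(V,E)$ be a finite simple undirected graph with edge weights $w\in\mathbb{R}_{\ge 0}^E$, and run a version of Edmonds' weighted perfect matching algorithm (as described in the context) satisfying the following condition: initially $\pi(U)=0$ for all $U$ with $|U|\ge3$ and $\pi(\{v\})=\beta$ for all $v\in V$, for some fixed $\beta\in\mathbb{R}$; and in every dual update step, the values $\pi(U)$ are increased by the same amount for all $U\in\mathcal{T}$ whose values are increased. Then every matching $\widetilde{M}$ of $G$ constructed during the algorithm is cardinality-optimal, i.e. $\sum_{e\in\widetilde{M}}w_e\le\sum_{e\in N}w_e$ for every matching $N$ of $G$ with $|N|=|\widetilde{M}|$.
   Context: Notation: $\mathcal{O}$ is the family of odd-cardinality subsets of $V$; for $U\subseteq V$, $\delta(U)$ is the set of edges with exactly one end in $U$ and $E[U]$ the set of edges with both ends in $U$. A family is laminar if any two members are disjoint or nested. Edmonds' algorithm (primal–dual version). The algorithm maintains: a laminar family $\Omega\subseteq\mathcal{O}$ containing all singletons; dual values $\pi:\mathcal{O}\to\mathbb{R}$ with $\pi(U)=0$ for $U\notin\Omega$, always satisfying (a) $\pi(U)\ge 0$ for all $U$ with $|U|\ge 3$ and (b) $\sum_{U:\,e\in\delta(U)}\pi(U)\le w_e$ for all $e\in E$; and a matching $M$ in the auxiliary graph $G'$, obtained from $G$ by deleting all edges for which (b) is strict and contracting each inclusion-wise maximal set of $\Omega$ (these sets, $\Omega_{\max}$, partition $V$) to a single node. Every $U\in\Omega$ with $|U|\ge3$ was created by shrinking a blossom (an odd cycle of $G'$); the algorithm correspondingly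 maintains a matching $\widetilde{M}$ of $G$ (obtained from $M$ by iteratively deshrinking the sets of $\Omega_{\max}$, using inside each blossom the near-perfect matching recorded for it and updated along even alternating paths of its cycle when an augmenting path passes through it) whose edges between distinct sets of $\Omega_{\max}$ are exactly the edges of $M$. Initially $M=\emptyset$, $\Omega$ consists of the singletons, and $\pi$ is a feasible initial dual supported on singletons. Each iteration: let $X$ be the set of nodes of $G'$ not covered by $M$. If $X=\emptyset$, stop. If $G'$ has an $M$-alternating walk between two nodes of $X$, take a shortest one; if it is a path, augment $M$ (and $\widetilde{M}$) along it; otherwise it contains a blossom, whose union $U$ of original nodes is added to $\Omega$ with $\pi(U)=0$ (shrinking). Otherwise, let $\mathcal{T}$ be the set of nodes of $G'$ reachable from $X$ by an even-length $M$-alternating path (including $X$) and $\mathcal{S}$ those reachable by an odd-length one; increase the duals $\pi(U)$ of (some of) the sets $U\in\mathcal{T}$ and decrease those of the corresponding sets in $\mathcal{S}$ as far as (a) and (b) permit (the basic version uses one common amount $\alpha$ for all of $\mathcal{T}\cup\mathcal{S}$; variants may use different amounts on different alternating trees). If the change can be arbitrarily large, stop and assert that $G$ has no perfect matching. Finally, every $U\in\Omega_{\max}$ with $|U|\ge 3$ and $\pi(U)=0$ is removed from $\Omega$ (deshrinking).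
   Formalization: In each dual update all sets U in T are required to change by one common amount, not only those whose values are increased; raising only some of T fails (E={ab,cd}, w(ab)=10, w(cd)=1, β=0, raise only π({a}) by 10, then augment along ab). *)

theory Defs
  imports Complex_Main
begin

definition simple_graph :: "'v set \<Rightarrow> 'v set set \<Rightarrow> bool" where
  "simple_graph V E \<longleftrightarrow> finite V \<and> (\<forall>e\<in>E. e \<subseteq> V \<and> card e = 2)"

definition matching :: "'v set set \<Rightarrow> 'v set set \<Rightarrow> bool" where
  "matching E M \<longleftrightarrow> M \<subseteq> E \<and> pairwise disjnt M"

definition cardinality_optimal :: "'v set set \<Rightarrow> ('v set \<Rightarrow> real) \<Rightarrow> 'v set set \<Rightarrow> bool" where
  "cardinality_optimal E w M \<longleftrightarrow>
     matching E M \<and> (\<forall>N. matching E N \<and> card N = card M \<longrightarrow> sum w M \<le> sum w N)"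

definition odd_sets :: "'v set \<Rightarrow> 'v set set" where
  "odd_sets V = {U. U \<subseteq> V \<and> odd (card U)}"

definition cut :: "'v set set \<Rightarrow> 'v set \<Rightarrow> 'v set set" where
  "cut E U = {e\<in>E. card (e \<inter> U) = 1}"

definition dual_load :: "'v set \<Rightarrow> 'v set set \<Rightarrow> ('v set \<Rightarrow> real) \<Rightarrow> 'v set \<Rightarrow> real" where
  "dual_load V E y e = (\<Sum>U | U \<in> odd_sets V \<and> e \<in> cut E U. y U)"

definition dual_feasible ::
  "'v set \<Rightarrow> 'v set set \<Rightarrow> ('v set \<Rightarrow> real) \<Rightarrow> ('v set \<Rightarrow> real) \<Rightarrow> bool" where
  "dual_feasible V E w y \<longleftrightarrow>
     (\<forall>U\<in>odd_sets V. 3 \<le> card U \<longrightarrow> 0 \<le> y U) \<and> (\<forall>e\<in>E. dual_load V E y e \<le> w e)"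

definition maximal_sets :: "'v set set \<Rightarrow> 'v set set" where
  "maximal_sets F = {U\<in>F. \<forall>W\<in>F. \<not> U \<subset> W}"

definition uncovered :: "'v set set \<Rightarrow> 'v set \<Rightarrow> bool" where
  "uncovered M U \<longleftrightarrow> (\<forall>e\<in>M. e \<inter> U = {})"

text \<open>
  Contracted graphs are given by a family \<open>\<N>\<close> of pairwise disjoint vertex sets (the nodes) and a set
  \<open>F\<close> of edges of the original graph. Edges keep their identity under contraction, so a walk is given
  by its nodes together with its edges; this accounts for parallel edges. An edge inside a single
  node (a loop) is never used.
\<close>

definition walk :: "'v set set \<Rightarrow> 'v set set \<Rightarrow> 'v set list \<Rightarrow> 'v set list \<Rightarrow> bool" where
  "walk \<N> F Us es \<longleftrightarrow>
     length Us = Suc (length es) \<and> set Us \<subseteq> \<N> \<and> set es \<subseteq> F \<and>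
     (\<forall>i<length es. Us ! i \<noteq> Us ! Suc i \<and> es ! i \<inter> Us ! i \<noteq> {} \<and> es ! i \<inter> Us ! Suc i \<noteq> {})"

definition alternating :: "'v set set \<Rightarrow> 'v set list \<Rightarrow> bool" where
  "alternating M es \<longleftrightarrow> (\<forall>i. Suc i < length es \<longrightarrow> (es ! i \<in> M) \<noteq> (es ! Suc i \<in> M))"

text \<open>
  State of the algorithm: the laminar family \<open>\<Omega>\<close> (\<open>family\<close>), the dual values \<open>\<pi>\<close> (\<open>dual\<close>), the
  matching \<open>M\<close> of the contracted graph (\<open>cmatch\<close>, as a set of edges of the original graph), and, for
  each blossom \<open>U\<close> of the family, the edges of the odd cycle that was shrunk (\<open>cycle\<close>) and the
  recorded near-perfect matching of this cycle (\<open>near\<close>). The values of \<open>cycle\<close> and \<open>near\<close> at sets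
  that are not blossoms of the family are irrelevant.
\<close>

record 'v state =
  family :: "'v set set"
  dual :: "'v set \<Rightarrow> real"
  cmatch :: "'v set set"
  cycle :: "'v set \<Rightarrow> 'v set set"
  near :: "'v set \<Rightarrow> 'v set set"

definition blossoms :: "'v state \<Rightarrow> 'v set set" where
  "blossoms s = {U \<in> family s. 3 \<le> card U}"

text \<open>Deshrinking \<open>U\<close> adds \<open>near s U\<close> to the matching; deshrinking everything gives \<open>M\<close> with a tilde.\<close>

definition full_matching :: "'v state \<Rightarrow> 'v set set" where
  "full_matching s = cmatch s \<union> \<Union> (near s ` blossoms s)"

definition nodes :: "'v state \<Rightarrow> 'v set set" where
  "nodes s = maximal_sets (family s)"

text \<open>The nodes of the cycle that was shrunk to the blossom \<open>U\<close>.\<close>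

definition cycle_nodes :: "'v state \<Rightarrow> 'v set \<Rightarrow> 'v set set" where
  "cycle_nodes s U = maximal_sets {W \<in> family s. W \<subset> U}"

definition tight_edges ::
  "'v set \<Rightarrow> 'v set set \<Rightarrow> ('v set \<Rightarrow> real) \<Rightarrow> 'v state \<Rightarrow> 'v set set" where
  "tight_edges V E w s = {e\<in>E. dual_load V E (dual s) e = w e}"

definition exposed_nodes :: "'v state \<Rightarrow> 'v set set" where
  "exposed_nodes s = {U \<in> nodes s. uncovered (cmatch s) U}"

definition alt_walk ::
  "'v set \<Rightarrow> 'v set set \<Rightarrow> ('v set \<Rightarrow> real) \<Rightarrow> 'v state \<Rightarrow> 'v set list \<Rightarrow> 'v set list \<Rightarrow> bool" where
  "alt_walk V E w s Us es \<longleftrightarrow> walk (nodes s) (tight_edges V E w s) Us es \<and> alternating (cmatch s) es"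

text \<open>The two end nodes may coincide, so that a blossom through an exposed node is found.\<close>

definition exposed_walk ::
  "'v set \<Rightarrow> 'v set set \<Rightarrow> ('v set \<Rightarrow> real) \<Rightarrow> 'v state \<Rightarrow> 'v set list \<Rightarrow> 'v set list \<Rightarrow> bool" where
  "exposed_walk V E w s Us es \<longleftrightarrow>
     alt_walk V E w s Us es \<and> es \<noteq> [] \<and> hd Us \<in> exposed_nodes s \<and> last Us \<in> exposed_nodes s"

definition shortest_exposed_walk ::
  "'v set \<Rightarrow> 'v set set \<Rightarrow> ('v set \<Rightarrow> real) \<Rightarrow> 'v state \<Rightarrow> 'v set list \<Rightarrow> 'v set list \<Rightarrow> bool" where
  "shortest_exposed_walk V E w s Us es \<longleftrightarrow>
     exposed_walk V E w s Us es \<and>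
     (\<forall>Us' es'. exposed_walk V E w s Us' es' \<longrightarrow> length es \<le> length es')"

definition outer_nodes ::
  "'v set \<Rightarrow> 'v set set \<Rightarrow> ('v set \<Rightarrow> real) \<Rightarrow> 'v state \<Rightarrow> 'v set set" where
  "outer_nodes V E w s =
     {U. \<exists>Us es. alt_walk V E w s Us es \<and> distinct Us \<and> even (length es) \<and>
                 hd Us \<in> exposed_nodes s \<and> last Us = U}"

definition inner_nodes ::
  "'v set \<Rightarrow> 'v set set \<Rightarrow> ('v set \<Rightarrow> real) \<Rightarrow> 'v state \<Rightarrow> 'v set set" where
  "inner_nodes V E w s =
     {U. \<exists>Us es. alt_walk V E w s Us es \<and> distinct Us \<and> odd (length es) \<and>
                 hd Us \<in> exposed_nodes s \<and> last Us = U}"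

text \<open>Edge sets of even alternating paths in the cycle of \<open>U\<close>, starting at the node missed by \<open>near s U\<close>.\<close>

definition even_cycle_path :: "'v state \<Rightarrow> 'v set \<Rightarrow> 'v set set \<Rightarrow> bool" where
  "even_cycle_path s U Q \<longleftrightarrow>
     (\<exists>Us es. walk (cycle_nodes s U) (cycle s U) Us es \<and> alternating (near s U) es \<and>
              distinct Us \<and> even (length es) \<and> uncovered (near s U) (hd Us) \<and> Q = set es)"

text \<open>
  Inside the nodes of the augmenting path, the matching of each blossom \<open>U\<close> is switched along an even
  alternating path of its cycle (with no edges if the augmenting path does not change the vertex of
  \<open>U\<close> that is matched outside \<open>U\<close>). The last condition determines where this path ends: if the new
  matching contains an edge leaving \<open>U\<close>, then \<open>near s' U\<close> misses the node of the cycle at which that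
  edge ends.
\<close>

definition augment_step ::
  "'v set \<Rightarrow> 'v set set \<Rightarrow> ('v set \<Rightarrow> real) \<Rightarrow> 'v state \<Rightarrow> 'v state \<Rightarrow> bool" where
  "augment_step V E w s s' \<longleftrightarrow>
     (\<exists>Us es N. shortest_exposed_walk V E w s Us es \<and> distinct Us \<and>
        s' = s\<lparr>cmatch := sym_diff (cmatch s) (set es), near := N\<rparr> \<and>
        (\<forall>U. U \<in> blossoms s \<and> (\<exists>B\<in>set Us. U \<subseteq> B) \<longrightarrow>
             (\<exists>Q. even_cycle_path s U Q \<and> N U = sym_diff (near s U) Q)) \<and>
        (\<forall>U. \<not> (U \<in> blossoms s \<and> (\<exists>B\<in>set Us. U \<subseteq> B)) \<longrightarrow> N U = near s U) \<and>
        (\<forall>U\<in>blossoms s. \<forall>e \<in> full_matching s' \<inter> cut E U. \<forall>W\<in>cycle_nodes s U.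
             e \<inter> W \<noteq> {} \<longrightarrow> uncovered (N U) W))"

definition shrink_step ::
  "'v set \<Rightarrow> 'v set set \<Rightarrow> ('v set \<Rightarrow> real) \<Rightarrow> 'v state \<Rightarrow> 'v state \<Rightarrow> bool" where
  "shrink_step V E w s s' \<longleftrightarrow>
     (\<exists>Us es i j. shortest_exposed_walk V E w s Us es \<and> \<not> distinct Us \<and>
        i < j \<and> j < length Us \<and> Us ! i = Us ! j \<and> odd (j - i) \<and>
        distinct (take (j - i) (drop i Us)) \<and>
        (let U = \<Union> (set (take (j - i) (drop i Us)));
             C = set (take (j - i) (drop i es))
         in s' = s\<lparr>family := insert U (family s), dual := (dual s)(U := 0),
                  cmatch := cmatch s - C,
                  cycle := (cycle s)(U := C), near := (near s)(U := cmatch s \<inter> C)\<rparr>))"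

text \<open>
  A partition of the outer and inner nodes into alternating trees rooted at the exposed nodes;
  \<open>r U\<close> is the root of the tree containing \<open>U\<close>.
\<close>

definition alternating_trees ::
  "'v set \<Rightarrow> 'v set set \<Rightarrow> ('v set \<Rightarrow> real) \<Rightarrow> 'v state \<Rightarrow> ('v set \<Rightarrow> 'v set) \<Rightarrow> bool" where
  "alternating_trees V E w s r \<longleftrightarrow>
     (\<forall>U \<in> outer_nodes V E w s \<union> inner_nodes V E w s.
        r U \<in> exposed_nodes s \<and>
        (\<exists>Us es. alt_walk V E w s Us es \<and> distinct Us \<and> hd Us = r U \<and> last Us = U \<and>
                 (\<forall>W\<in>set Us. r W = r U)))"

definition shifted_dual ::
  "'v set \<Rightarrow> 'v set set \<Rightarrow> ('v set \<Rightarrow> real) \<Rightarrow> 'v state \<Rightarrow> ('v set \<Rightarrow> real) \<Rightarrow> 'v set \<Rightarrow> real" where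
  "shifted_dual V E w s a U =
     (if U \<in> outer_nodes V E w s then dual s U + a U
      else if U \<in> inner_nodes V E w s then dual s U - a U
      else dual s U)"

text \<open>
  The amount may depend on the alternating tree: \<open>d\<close> gives the relative amounts for the roots (zero
  for trees that are not changed), and the change \<open>\<alpha> * d\<close> is made as large as feasibility permits.
  There is no successor state if the change can be arbitrarily large. The blossoms whose dual value
  has become zero are deshrunk, which does not change the matching of the original graph.
\<close>

definition dual_step ::
  "'v set \<Rightarrow> 'v set set \<Rightarrow> ('v set \<Rightarrow> real) \<Rightarrow> 'v state \<Rightarrow> 'v state \<Rightarrow> bool" where
  "dual_step V E w s s' \<longleftrightarrow>
     (\<nexists>Us es. exposed_walk V E w s Us es) \<and>
     (\<exists>r d \<alpha>. alternating_trees V E w s r \<and>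
        (\<forall>x\<in>exposed_nodes s. 0 \<le> d x) \<and> (\<exists>x\<in>exposed_nodes s. 0 < d x) \<and> 0 \<le> \<alpha> \<and>
        dual_feasible V E w (shifted_dual V E w s (\<lambda>U. \<alpha> * d (r U))) \<and>
        (\<forall>\<alpha>'>\<alpha>. \<not> dual_feasible V E w (shifted_dual V E w s (\<lambda>U. \<alpha>' * d (r U)))) \<and>
        (let y = shifted_dual V E w s (\<lambda>U. \<alpha> * d (r U));
             D = {U \<in> nodes s. 3 \<le> card U \<and> y U = 0}
         in s' = s\<lparr>family := family s - D, dual := y, cmatch := cmatch s \<union> \<Union> (near s ` D)\<rparr>))"

definition edmonds_init ::
  "'v set \<Rightarrow> 'v set set \<Rightarrow> ('v set \<Rightarrow> real) \<Rightarrow> 'v state \<Rightarrow> bool" where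
  "edmonds_init V E w s \<longleftrightarrow>
     family s = (\<lambda>v. {v}) ` V \<and> cmatch s = {} \<and>
     (\<forall>U. U \<notin> family s \<longrightarrow> dual s U = 0) \<and> dual_feasible V E w (dual s)"

definition edmonds_iteration ::
  "'v set \<Rightarrow> 'v set set \<Rightarrow> ('v set \<Rightarrow> real) \<Rightarrow> 'v state \<Rightarrow> 'v state \<Rightarrow> bool" where
  "edmonds_iteration V E w s s' \<longleftrightarrow>
     exposed_nodes s \<noteq> {} \<and>
     (augment_step V E w s s' \<or> shrink_step V E w s s' \<or> dual_step V E w s s')"

definition edmonds_run ::
  "'v set \<Rightarrow> 'v set set \<Rightarrow> ('v set \<Rightarrow> real) \<Rightarrow> (nat \<Rightarrow> 'v state) \<Rightarrow> nat \<Rightarrow> bool" where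
  "edmonds_run V E w s n \<longleftrightarrow>
     edmonds_init V E w (s 0) \<and> (\<forall>i<n. edmonds_iteration V E w (s i) (s (Suc i)))"

end

theory Submission
  imports Defs
begin

text \<open>
  Let the potential of a vertex be the sum of the dual values of the odd sets containing it. A dual update
  changes every potential by at most the common amount \<open>\<delta>\<close>, and by exactly \<open>\<delta>\<close> at an uncovered vertex,
  because the maximal set containing such a vertex is exposed and hence outer. Since all potentials are
  equal at the start and no covered vertex is ever uncovered again, the uncovered vertices always have
  maximal potential.

  Summing the loads of the edges of a matching \<open>N\<close> gives the sum of the potentials of the vertices covered
  by \<open>N\<close> minus twice the sum over \<open>U\<close> of \<open>\<pi>(U) |N \<inter> E[U]|\<close>. Among all matchings of the same cardinality
  this is smallest for the matching of the algorithm: it leaves only vertices of maximal potential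
  uncovered and it is near-perfect inside every set of the family. As it uses tight edges only, it is
  optimal.
\<close>

section \<open>Matchings and odd sets\<close>

definition edges_inside :: "'v set set \<Rightarrow> 'v set \<Rightarrow> 'v set set" where
  "edges_inside N U = {e\<in>N. e \<subseteq> U}"

definition near_perfect_inside :: "'v set set \<Rightarrow> 'v set \<Rightarrow> bool" where
  "near_perfect_inside M U \<longleftrightarrow> (\<exists>z\<in>U. U - {z} \<subseteq> \<Union> (edges_inside M U))"

lemma finite_odd_sets: "finite V \<Longrightarrow> finite (odd_sets V)"
  unfolding odd_sets_def by (rule finite_subset[of _ "Pow V"]) auto

lemma matching_edge:
  assumes "simple_graph V E" "matching E N" "e \<in> N"
  shows "e \<in> E" "e \<subseteq> V" "card e = 2" "finite e"
proof -
  show "e \<in> E" using assms by (auto simp: matching_def)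
  then show "e \<subseteq> V" "card e = 2" using assms by (auto simp: simple_graph_def)
  then show "finite e" using card.infinite by fastforce
qed

lemma finite_matching: "simple_graph V E \<Longrightarrow> matching E N \<Longrightarrow> finite N"
  using matching_edge(2) finite_subset[of N "Pow V"] by (metis PowI finite_Pow_iff simple_graph_def subsetI)

lemma matching_disjoint: "matching E N \<Longrightarrow> e \<in> N \<Longrightarrow> f \<in> N \<Longrightarrow> e \<noteq> f \<Longrightarrow> e \<inter> f = {}"
  unfolding matching_def pairwise_def disjnt_def by blast

lemma matching_edges_inside: "matching E N \<Longrightarrow> matching E (edges_inside N U)"
  unfolding matching_def edges_inside_def pairwise_def by blast

lemma card_matching_vertices:
  assumes "simple_graph V E" "matching E N"
  shows "card (\<Union> N) = 2 * card N"
proof -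
  have "card (\<Union> N) = (\<Sum>e\<in>N. card e)"
    using assms(2) matching_edge(4)[OF assms] by (intro card_Union_disjoint) (auto simp: matching_def)
  also have "\<dots> = (\<Sum>e\<in>N. 2)" by (rule sum.cong) (use matching_edge[OF assms] in auto)
  finally show ?thesis by simp
qed

lemma card_edges_inside_le:
  assumes "simple_graph V E" "matching E N" "U \<in> odd_sets V"
  shows "2 * card (edges_inside N U) \<le> card U - 1"
proof -
  have U: "finite U" "odd (card U)"
    using assms(1,3) finite_subset by (auto simp: simple_graph_def odd_sets_def)
  have "2 * card (edges_inside N U) = card (\<Union> (edges_inside N U))"
    using card_matching_vertices[OF assms(1) matching_edges_inside[OF assms(2)]] by simp
  moreover have "card (\<Union> (edges_inside N U)) \<le> card U"
    by (rule card_mono) (auto simp: U edges_inside_def)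
  ultimately show ?thesis using U(2) by presburger
qed

lemma card_edges_inside_near_perfect:
  assumes "simple_graph V E" "matching E M" "U \<in> odd_sets V" "near_perfect_inside M U"
  shows "2 * card (edges_inside M U) = card U - 1"
proof (rule antisym[OF card_edges_inside_le[OF assms(1-3)]])
  obtain z where z: "z \<in> U" "U - {z} \<subseteq> \<Union> (edges_inside M U)"
    using assms(4) unfolding near_perfect_inside_def by blast
  have "finite U" using assms(1,3) finite_subset by (auto simp: simple_graph_def odd_sets_def)
  then have "finite (\<Union> (edges_inside M U))" by (rule finite_subset[rotated]) (auto simp: edges_inside_def)
  then have "card (U - {z}) \<le> card (\<Union> (edges_inside M U))" using z(2) by (rule card_mono)
  then show "card U - 1 \<le> 2 * card (edges_inside M U)"
    using z(1) card_matching_vertices[OF assms(1) matching_edges_inside[OF assms(2)]] by simp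
qed

lemma near_perfect_inside_covered_by_crossing_edge:
  assumes "matching E M" "near_perfect_inside M U" "f \<in> M" "f \<inter> U \<noteq> {}" "\<not> f \<subseteq> U"
  shows "U \<subseteq> \<Union> (edges_inside M U) \<union> f"
proof -
  obtain z where z: "U - {z} \<subseteq> \<Union> (edges_inside M U)"
    using assms(2) unfolding near_perfect_inside_def by blast
  have "f \<inter> \<Union> (edges_inside M U) = {}"
    using matching_disjoint[OF assms(1,3)] assms(5) by (auto simp: edges_inside_def)
  then have "z \<in> f" using z assms(4) by blast
  then show ?thesis using z by blast
qed

lemma card_edge_Int_eq_1_if_crossing:
  assumes "card e = 2" "e \<inter> A \<noteq> {}" "\<not> e \<subseteq> A"
  shows "card (e \<inter> A) = 1"
proof -
  have "finite e" using assms(1) card.infinite by fastforce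
  then have "0 < card (e \<inter> A)" "card (e \<inter> A) < card e"
    using assms(2,3) by (auto simp: card_gt_0_iff intro: psubset_card_mono)
  then show ?thesis using assms(1) by simp
qed

lemma odd_card_Union_iff:
  assumes "finite P" "pairwise disjnt P" "\<And>A. A \<in> P \<Longrightarrow> odd (card A)"
  shows "odd (card (\<Union> P)) \<longleftrightarrow> odd (card P)"
proof -
  have "finite A" if "A \<in> P" for A using assms(3)[OF that] card.infinite by force
  then have "card (\<Union> P) = (\<Sum>A\<in>P. card A)" by (rule card_Union_disjoint[OF assms(2)])
  moreover have "{A \<in> P. odd (card A)} = P" using assms(3) by blast
  ultimately show ?thesis using even_sum_iff[OF assms(1), of card] by simp
qed

section \<open>Walks in contracted graphs\<close>

definition incident :: "'v set set \<Rightarrow> 'v set \<Rightarrow> 'v set set" where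
  "incident M B = {e\<in>M. e \<inter> B \<noteq> {}}"

lemma uncovered_iff_incident_empty: "uncovered M B \<longleftrightarrow> incident M B = {}"
  by (auto simp: uncovered_def incident_def)

lemma incident_sym_diff: "incident (sym_diff M P) B = sym_diff (incident M B) (incident P B)"
  by (auto simp: incident_def)

lemma walk_length: "walk \<N> F Us es \<Longrightarrow> length Us = Suc (length es)"
  by (simp add: walk_def)

lemma walk_node_in: "walk \<N> F Us es \<Longrightarrow> i \<le> length es \<Longrightarrow> Us ! i \<in> \<N>"
  unfolding walk_def by (metis le_imp_less_Suc nth_mem subsetD)

lemma walk_edge_in: "walk \<N> F Us es \<Longrightarrow> i < length es \<Longrightarrow> es ! i \<in> F"
  unfolding walk_def by (metis nth_mem subsetD)

lemma walk_edge_ends: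
  assumes "walk \<N> F Us es" "i < length es"
  shows "Us ! i \<noteq> Us ! Suc i" "es ! i \<inter> Us ! i \<noteq> {}" "es ! i \<inter> Us ! Suc i \<noteq> {}"
  using assms by (simp_all add: walk_def)

lemma walk_hd: "walk \<N> F Us es \<Longrightarrow> hd Us = Us ! 0"
  using walk_length hd_conv_nth[of Us] by (metis list.size(3) nat.distinct(1))

lemma walk_last: "walk \<N> F Us es \<Longrightarrow> last Us = Us ! length es"
  using walk_length last_conv_nth[of Us] by (metis diff_Suc_1 list.size(3) nat.distinct(1))

lemma walk_hd_in: "walk \<N> F Us es \<Longrightarrow> hd Us \<in> \<N>"
  by (simp add: walk_hd walk_node_in)

lemma walk_last_in: "walk \<N> F Us es \<Longrightarrow> last Us \<in> \<N>"
  by (simp add: walk_last walk_node_in)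

lemma walk_rev:
  assumes "walk \<N> F Us es" shows "walk \<N> F (rev Us) (rev es)"
proof -
  have "rev Us ! i \<noteq> rev Us ! Suc i \<and> rev es ! i \<inter> rev Us ! i \<noteq> {} \<and> rev es ! i \<inter> rev Us ! Suc i \<noteq> {}"
    if i: "i < length es" for i
  proof -
    define j where "j = length es - Suc i"
    have j: "j < length es" "length es - i = Suc j" using i by (auto simp: j_def)
    have "rev Us ! i = Us ! Suc j" "rev Us ! Suc i = Us ! j" "rev es ! i = es ! j"
      using i j walk_length[OF assms] by (auto simp: rev_nth j_def)
    then show ?thesis using walk_edge_ends[OF assms j(1)] by simp
  qed
  then show ?thesis using assms by (simp add: walk_def)
qed

lemma walk_append:
  assumes "walk \<N> F Us es" "walk \<N> F Us' es'" "last Us = hd Us'"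
  shows "walk \<N> F (Us @ tl Us') (es @ es')"
proof -
  have lengths: "length Us = Suc (length es)" "length Us' = Suc (length es')"
    using assms walk_length by blast+
  have nth_second: "(Us @ tl Us') ! (length es + j) = Us' ! j" if "j \<le> length es'" for j
  proof (cases j)
    case 0
    then show ?thesis using lengths assms(3) walk_last[OF assms(1)] walk_hd[OF assms(2)]
      by (simp add: nth_append)
  next
    case (Suc k)
    then show ?thesis using lengths that by (simp add: nth_append nth_tl)
  qed
  have "(Us @ tl Us') ! i \<noteq> (Us @ tl Us') ! Suc i \<and> (es @ es') ! i \<inter> (Us @ tl Us') ! i \<noteq> {} \<and>
        (es @ es') ! i \<inter> (Us @ tl Us') ! Suc i \<noteq> {}"
    if i: "i < length (es @ es')" for i
  proof (cases "i < length es")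
    case True
    then show ?thesis using walk_edge_ends[OF assms(1) True] lengths by (simp add: nth_append)
  next
    case False
    then obtain j where j: "i = length es + j" "j < length es'"
      using i by (metis add_less_cancel_left le_Suc_ex length_append not_le)
    then show ?thesis using walk_edge_ends[OF assms(2) j(2)] nth_second[of j] nth_second[of "Suc j"]
      by (simp add: nth_append)
  qed
  moreover have "set (tl Us') \<subseteq> set Us'" by (cases Us') auto
  ultimately show ?thesis using assms(1,2) lengths by (auto simp: walk_def)
qed

lemma walk_butlast: "walk \<N> F Us es \<Longrightarrow> es \<noteq> [] \<Longrightarrow> walk \<N> F (butlast Us) (butlast es)"
  unfolding walk_def by (auto simp: nth_butlast dest: in_set_butlastD)

lemma edge_subset_Un_if_meets_both:
  assumes "card e = 2" "A \<inter> B = {}" "e \<inter> A \<noteq> {}" "e \<inter> B \<noteq> {}"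
  shows "e \<subseteq> A \<union> B"
proof -
  obtain x y where "e = {x, y}" using assms(1) by (auto simp: card_2_iff)
  then show ?thesis using assms(2-4) by auto
qed

locale contracted_graph =
  fixes \<N> :: "'v set set" and F :: "'v set set"
  assumes nodes_disjoint: "pairwise disjnt \<N>"
    and edge_card: "e \<in> F \<Longrightarrow> card e = 2"
begin

lemma node_eqI: "A \<in> \<N> \<Longrightarrow> B \<in> \<N> \<Longrightarrow> A \<inter> B \<noteq> {} \<Longrightarrow> A = B"
  using nodes_disjoint unfolding pairwise_def disjnt_def by blast

context
  fixes Us es i
  assumes walk: "walk \<N> F Us es" and i_less: "i < length es"
begin

lemma walk_edge_subset: "es ! i \<subseteq> Us ! i \<union> Us ! Suc i"
proof (rule edge_subset_Un_if_meets_both)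
  show "card (es ! i) = 2" using edge_card walk_edge_in[OF walk i_less] .
  show "Us ! i \<inter> Us ! Suc i = {}"
    using node_eqI walk_node_in[OF walk] walk_edge_ends(1)[OF walk i_less] i_less
    by (meson Suc_leI less_imp_le)
qed (use walk_edge_ends[OF walk i_less] in auto)

lemma walk_edge_meets_iff:
  assumes "B \<in> \<N>"
  shows "es ! i \<inter> B \<noteq> {} \<longleftrightarrow> B = Us ! i \<or> B = Us ! Suc i"
proof
  assume "es ! i \<inter> B \<noteq> {}"
  then have "Us ! i \<inter> B \<noteq> {} \<or> Us ! Suc i \<inter> B \<noteq> {}" using walk_edge_subset by blast
  then show "B = Us ! i \<or> B = Us ! Suc i"
    using node_eqI assms walk_node_in[OF walk] i_less by (metis Suc_leI less_imp_le)
qed (use walk_edge_ends[OF walk i_less] in blast)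

lemma walk_edge_not_inside:
  assumes "B \<in> \<N>" shows "\<not> es ! i \<subseteq> B"
proof
  assume "es ! i \<subseteq> B"
  then have "Us ! i \<inter> B \<noteq> {}" "Us ! Suc i \<inter> B \<noteq> {}" using walk_edge_ends[OF walk i_less] by blast+
  then show False
    using node_eqI[OF _ assms] walk_node_in[OF walk] walk_edge_ends(1)[OF walk i_less] i_less
    by (metis Suc_leI less_imp_le)
qed

end

lemma path_incident:
  assumes "walk \<N> F Us es" "distinct Us" "k \<le> length es"
  shows "incident (set es) (Us ! k) = {es ! i | i. i < length es \<and> (i = k \<or> Suc i = k)}"
proof -
  have "es ! i \<inter> Us ! k \<noteq> {} \<longleftrightarrow> i = k \<or> Suc i = k" if "i < length es" for i
  proof -
    have "es ! i \<inter> Us ! k \<noteq> {} \<longleftrightarrow> Us ! k = Us ! i \<or> Us ! k = Us ! Suc i"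
      by (rule walk_edge_meets_iff[OF assms(1) that walk_node_in[OF assms(1,3)]])
    also have "\<dots> \<longleftrightarrow> i = k \<or> Suc i = k"
      using that assms walk_length[OF assms(1)] by (auto simp: nth_eq_iff_index_eq)
    finally show ?thesis .
  qed
  then show ?thesis by (force simp: incident_def in_set_conv_nth)
qed

lemma incident_off_walk:
  assumes "walk \<N> F Us es" "B \<in> \<N>" "B \<notin> set Us"
  shows "incident (set es) B = {}"
proof -
  have "Us ! i \<in> set Us" "Us ! Suc i \<in> set Us" if "i < length es" for i
    using that walk_length[OF assms(1)] by auto
  then show ?thesis
    using walk_edge_meets_iff[OF assms(1) _ assms(2)] assms(3)
    unfolding incident_def in_set_conv_nth by blast
qed

end

section \<open>Alternating walks from uncovered nodes\<close>

definition node_matching :: "'v set set \<Rightarrow> 'v set set \<Rightarrow> 'v set set \<Rightarrow> bool" where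
  "node_matching \<N> F M \<longleftrightarrow> M \<subseteq> F \<and>
     (\<forall>B\<in>\<N>. (\<forall>e\<in>M. \<not> e \<subseteq> B) \<and> (\<forall>e\<in>incident M B. \<forall>f\<in>incident M B. e = f))"

definition near_perfect_matching :: "'v set set \<Rightarrow> 'v set set \<Rightarrow> 'v set set \<Rightarrow> bool" where
  "near_perfect_matching \<N> F M \<longleftrightarrow> node_matching \<N> F M \<and>
     (\<forall>A\<in>\<N>. \<forall>B\<in>\<N>. uncovered M A \<longrightarrow> uncovered M B \<longrightarrow> A = B)"

lemma node_matchingI:
  assumes "M \<subseteq> F" "\<And>B e. B \<in> \<N> \<Longrightarrow> e \<in> M \<Longrightarrow> \<not> e \<subseteq> B"
    and "\<And>B e f. B \<in> \<N> \<Longrightarrow> e \<in> incident M B \<Longrightarrow> f \<in> incident M B \<Longrightarrow> e = f"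
  shows "node_matching \<N> F M"
  using assms unfolding node_matching_def by blast

lemma node_matching_subset: "node_matching \<N> F M \<Longrightarrow> M \<subseteq> F"
  unfolding node_matching_def by blast

lemma node_matching_not_inside: "node_matching \<N> F M \<Longrightarrow> B \<in> \<N> \<Longrightarrow> e \<in> M \<Longrightarrow> \<not> e \<subseteq> B"
  unfolding node_matching_def by blast

lemma node_matching_unique:
  "node_matching \<N> F M \<Longrightarrow> B \<in> \<N> \<Longrightarrow> e \<in> incident M B \<Longrightarrow> f \<in> incident M B \<Longrightarrow> e = f"
  unfolding node_matching_def by blast

lemma node_matching_restrict:
  assumes "node_matching \<N> F M" "\<N>' \<subseteq> \<N>" "M' \<subseteq> M" "M' \<subseteq> F'"
  shows "node_matching \<N>' F' M'"
proof (rule node_matchingI[OF assms(4)])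
  fix B assume "B \<in> \<N>'"
  then have B: "B \<in> \<N>" using assms(2) by blast
  have "incident M' B \<subseteq> incident M B" using assms(3) by (auto simp: incident_def)
  then show "e = f" if "e \<in> incident M' B" "f \<in> incident M' B" for e f
    using node_matching_unique[OF assms(1) B] that by blast
  show "\<not> e \<subseteq> B" if "e \<in> M'" for e using node_matching_not_inside[OF assms(1) B] that assms(3) by blast
qed

locale contracted_matching = contracted_graph +
  fixes M :: "'a set set"
  assumes matching_of_nodes: "node_matching \<N> F M"
begin

lemmas matched_not_inside = node_matching_not_inside[OF matching_of_nodes]
  and matched_unique = node_matching_unique[OF matching_of_nodes]

definition rooted_walk :: "'a set list \<Rightarrow> 'a set list \<Rightarrow> bool" where
  "rooted_walk Us es \<longleftrightarrow> walk \<N> F Us es \<and> alternating M es \<and> uncovered M (hd Us)"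

lemma rooted_walk_walk: "rooted_walk Us es \<Longrightarrow> walk \<N> F Us es"
  by (simp add: rooted_walk_def)

lemma rooted_walk_edge_matched_iff:
  assumes "rooted_walk Us es" "i < length es"
  shows "es ! i \<in> M \<longleftrightarrow> odd i"
  using assms(2)
proof (induction i)
  case 0
  have "es ! 0 \<inter> hd Us \<noteq> {}"
    using walk_edge_ends(2)[OF rooted_walk_walk[OF assms(1)] 0] walk_hd[OF rooted_walk_walk[OF assms(1)]]
    by simp
  then show ?case using assms(1) by (auto simp: rooted_walk_def uncovered_def)
next
  case (Suc i)
  then show ?case using assms(1) unfolding rooted_walk_def alternating_def by auto
qed

lemma rooted_walkI:
  assumes "walk \<N> F Us es" "uncovered M (hd Us)" "\<And>i. i < length es \<Longrightarrow> es ! i \<in> M \<longleftrightarrow> odd i"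
  shows "rooted_walk Us es"
  using assms by (simp add: rooted_walk_def alternating_def)

lemma rooted_walk_incident:
  assumes rooted: "rooted_walk Us es" and k: "k \<le> length es"
    and end_uncovered: "odd (length es) \<Longrightarrow> k = length es \<Longrightarrow> uncovered M (last Us)"
  shows "incident M (Us ! k) = {es ! i | i. i < length es \<and> odd i \<and> (i = k \<or> Suc i = k)}"
proof
  note walk = rooted_walk_walk[OF rooted]
  show "{es ! i | i. i < length es \<and> odd i \<and> (i = k \<or> Suc i = k)} \<subseteq> incident M (Us ! k)"
    using rooted_walk_edge_matched_iff[OF rooted] walk_edge_ends[OF walk] by (auto simp: incident_def)
  show "incident M (Us ! k) \<subseteq> {es ! i | i. i < length es \<and> odd i \<and> (i = k \<or> Suc i = k)}"
  proof
    fix e assume e: "e \<in> incident M (Us ! k)"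
    have "\<not> uncovered M (Us ! k)" using e by (auto simp: uncovered_iff_incident_empty)
    then have ends: "0 < k" "\<not> (k = length es \<and> odd k)"
      using end_uncovered rooted walk_hd[OF walk] walk_last[OF walk]
      by (auto simp: rooted_walk_def intro: gr0I)
    define i where "i = (if odd k then k else k - 1)"
    have i: "i < length es" "odd i" "i = k \<or> Suc i = k" using ends k by (auto simp: i_def le_less)
    then have "es ! i \<in> incident M (Us ! k)"
      using rooted_walk_edge_matched_iff[OF rooted] walk_edge_ends[OF walk] by (auto simp: incident_def)
    then have "e = es ! i" using matched_unique[OF walk_node_in[OF walk k] e] by blast
    then show "e \<in> {es ! i | i. i < length es \<and> odd i \<and> (i = k \<or> Suc i = k)}" using i by blast
  qed
qed

lemma rooted_walk_to_uncovered_odd: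
  assumes "rooted_walk Us es" "es \<noteq> []" "uncovered M (last Us)"
  shows "odd (length es)"
proof
  note walk = rooted_walk_walk[OF assms(1)]
  assume "even (length es)"
  then obtain k where k: "length es = Suc k" "odd k" using assms(2) by (cases es) auto
  then have "es ! k \<in> M" using rooted_walk_edge_matched_iff[OF assms(1)] by simp
  moreover have "es ! k \<inter> last Us \<noteq> {}"
    using walk_edge_ends(3)[OF walk, of k] walk_last[OF walk] k by simp
  ultimately show False using assms(3) by (auto simp: uncovered_def)
qed

lemma rooted_walk_join:
  assumes "rooted_walk Us es" "rooted_walk Us' es'" "last Us = last Us'" "odd (length es + length es')"
  shows "rooted_walk (Us @ tl (rev Us')) (es @ rev es')" "last (Us @ tl (rev Us')) = hd Us'"
proof -
  have nonempty: "Us \<noteq> []" "Us' \<noteq> []" using assms(1,2) walk_length rooted_walk_walk by force+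
  show "rooted_walk (Us @ tl (rev Us')) (es @ rev es')"
  proof (rule rooted_walkI)
    show "walk \<N> F (Us @ tl (rev Us')) (es @ rev es')"
      using assms nonempty by (intro walk_append walk_rev rooted_walk_walk) (simp_all add: hd_rev)
    show "uncovered M (hd (Us @ tl (rev Us')))" using assms(1) nonempty by (simp add: rooted_walk_def)
    fix i assume i: "i < length (es @ rev es')"
    show "(es @ rev es') ! i \<in> M \<longleftrightarrow> odd i"
    proof (cases "i < length es")
      case True
      then show ?thesis using rooted_walk_edge_matched_iff[OF assms(1)] by (simp add: nth_append)
    next
      case False
      define k where "k = length es' - Suc (i - length es)"
      have "k < length es'" "(es @ rev es') ! i = es' ! k"
        using False i by (auto simp: k_def nth_append rev_nth)
      moreover have "length es + length es' = Suc (i + k)" using False i by (auto simp: k_def)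
      then have "even (i + k)" using assms(4) by simp
      ultimately show ?thesis using rooted_walk_edge_matched_iff[OF assms(2), of k] by auto
    qed
  qed
  have "rev Us' = last Us # tl (rev Us')"
    using assms(3) nonempty by (metis hd_Cons_tl hd_rev rev_is_Nil_conv)
  then have "last (rev Us') = last (Us @ tl (rev Us'))"
    using nonempty by (metis last_ConsL last_ConsR last_append)
  then show "last (Us @ tl (rev Us')) = hd Us'" using nonempty by (simp add: last_rev)
qed

definition even_reachable :: "'a set set" where
  "even_reachable = {last Us | Us es. rooted_walk Us es \<and> distinct Us \<and> even (length es)}"

definition odd_reachable :: "'a set set" where
  "odd_reachable = {last Us | Us es. rooted_walk Us es \<and> distinct Us \<and> odd (length es)}"

lemma reachable_subset_nodes: "even_reachable \<union> odd_reachable \<subseteq> \<N>"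
  using walk_last_in rooted_walk_walk by (fastforce simp: even_reachable_def odd_reachable_def)

lemma uncovered_even_reachable:
  assumes "B \<in> \<N>" "uncovered M B" shows "B \<in> even_reachable"
proof -
  have "rooted_walk [B] []" using assms by (simp add: rooted_walk_def walk_def alternating_def)
  then show ?thesis by (force simp: even_reachable_def)
qed

lemma even_odd_reachable_disjoint:
  assumes "\<And>Us es. rooted_walk Us es \<Longrightarrow> es \<noteq> [] \<Longrightarrow> \<not> uncovered M (last Us)"
  shows "even_reachable \<inter> odd_reachable = {}"
proof -
  have False if walks: "rooted_walk Us es" "even (length es)" "rooted_walk Us' es'" "odd (length es')"
    "last Us = last Us'" for Us es Us' es'
  proof -
    have "es' \<noteq> []" using walks(4) by auto
    moreover have "odd (length es + length es')" using walks(2,4) by simp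
    note rooted_walk_join[OF walks(1,3,5) this]
    moreover have "uncovered M (hd Us')" using walks(3) by (simp add: rooted_walk_def)
    ultimately show False using assms by fastforce
  qed
  then show ?thesis unfolding even_reachable_def odd_reachable_def disjoint_iff mem_Collect_eq by metis
qed

context
  fixes e A B
  assumes matched: "e \<in> M" "e \<inter> A \<noteq> {}" "e \<inter> B \<noteq> {}" and ends: "A \<in> \<N>" "B \<in> \<N>" "A \<noteq> B"
begin

lemma odd_reachable_if_matched_to_even_reachable:
  assumes "A \<in> even_reachable" shows "B \<in> odd_reachable"
proof -
  obtain Us es where rooted: "rooted_walk Us es" and path: "distinct Us" "even (length es)" "last Us = A"
    using assms unfolding even_reachable_def by blast
  note walk = rooted_walk_walk[OF rooted]
  have "e \<in> incident M (Us ! length es)"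
    using matched walk_last[OF walk] path(3) by (simp add: incident_def)
  then obtain i where i: "e = es ! i" "length es = Suc i" "odd i"
    using rooted_walk_incident[OF rooted, of "length es"] path(2) by auto
  have "B = Us ! i"
    using walk_edge_meets_iff[OF walk, of i B] ends matched(3) i walk_last[OF walk] path(3) by auto
  moreover have length_Us: "length Us = Suc (Suc i)" using i walk_length[OF walk] by simp
  ultimately have "last (butlast Us) = B"
    by (subst last_conv_nth) (auto simp: nth_butlast simp flip: length_greater_0_conv)
  moreover have "rooted_walk (butlast Us) (butlast es)"
  proof (rule rooted_walkI)
    have "es \<noteq> []" using i(2) by auto
    then show "walk \<N> F (butlast Us) (butlast es)" by (rule walk_butlast[OF walk])
    show "uncovered M (hd (butlast Us))" using rooted length_Us by (cases Us) (auto simp: rooted_walk_def)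
  qed (use rooted_walk_edge_matched_iff[OF rooted] i in \<open>simp add: nth_butlast\<close>)
  ultimately show ?thesis
    unfolding odd_reachable_def using path i
    by (intro CollectI exI[of _ "butlast Us"] exI[of _ "butlast es"]) (simp add: distinct_butlast)
qed

lemma even_reachable_if_matched_to_odd_reachable:
  assumes "A \<in> odd_reachable" shows "B \<in> even_reachable"
proof -
  obtain Us es where rooted: "rooted_walk Us es" and path: "distinct Us" "odd (length es)" "last Us = A"
    using assms unfolding odd_reachable_def by blast
  note walk = rooted_walk_walk[OF rooted]
  have "B \<notin> set Us"
  proof
    assume "B \<in> set Us"
    then obtain k where k: "k \<le> length es" "Us ! k = B"
      using walk_length[OF walk] by (auto simp: in_set_conv_nth less_Suc_eq_le)
    have "k \<noteq> length es" using k(2) ends(3) walk_last[OF walk] path(3) by metis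
    then have "incident M (Us ! k) = {es ! i | i. i < length es \<and> odd i \<and> (i = k \<or> Suc i = k)}"
      by (intro rooted_walk_incident[OF rooted k(1)]) blast
    moreover have "e \<in> incident M (Us ! k)" using matched k(2) by (simp add: incident_def)
    ultimately obtain i where i: "i < length es" "odd i" "e = es ! i" by auto
    then have "Us ! length es = Us ! i \<or> Us ! length es = Us ! Suc i"
      using walk_edge_meets_iff[OF walk, of i A] ends(1) matched(2) walk_last[OF walk] path(3) by simp
    then have "length es = i \<or> length es = Suc i"
      using i(1) walk_length[OF walk] by (simp add: nth_eq_iff_index_eq[OF path(1)])
    then have "length es = Suc i" using i(1) by simp
    then show False using path(2) i by simp
  qed
  moreover have "rooted_walk (Us @ [B]) (es @ [e])"
  proof (rule rooted_walkI)
    have "e \<in> F" using node_matching_subset[OF matching_of_nodes] matched by blast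
    then have "walk \<N> F [A, B] [e]" using matched ends by (simp add: walk_def)
    from walk_append[OF walk this] show "walk \<N> F (Us @ [B]) (es @ [e])" using path(3) by simp
    show "uncovered M (hd (Us @ [B]))"
      using rooted walk_length[OF walk] by (cases Us) (auto simp: rooted_walk_def)
    show "(es @ [e]) ! i \<in> M \<longleftrightarrow> odd i" if "i < length (es @ [e])" for i
      using rooted_walk_edge_matched_iff[OF rooted, of i] matched(1) path(2) that
      by (cases "i < length es") (simp_all add: nth_append less_Suc_eq)
  qed
  ultimately show ?thesis
    unfolding even_reachable_def using path
    by (intro CollectI exI[of _ "Us @ [B]"] exI[of _ "es @ [e]"]) simp
qed

end

end

locale switching_path = contracted_matching +
  fixes Us es
  assumes rooted: "rooted_walk Us es" and distinct_nodes: "distinct Us"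
    and end_uncovered: "odd (length es) \<Longrightarrow> uncovered M (last Us)"
begin

lemmas walk = rooted_walk_walk[OF rooted]

lemma incident_switch_on_path:
  assumes "k \<le> length es"
  shows "incident (sym_diff M (set es)) (Us ! k) =
         {es ! i | i. i < length es \<and> even i \<and> (i = k \<or> Suc i = k)}"
proof -
  have "incident M (Us ! k) \<subseteq> set es"
    using end_uncovered by (subst rooted_walk_incident[OF rooted assms]) auto
  then have "incident (sym_diff M (set es)) (Us ! k) = incident (set es) (Us ! k) - M"
    by (auto simp: incident_def)
  also have "\<dots> = {es ! i | i. i < length es \<and> even i \<and> (i = k \<or> Suc i = k)}"
    using rooted_walk_edge_matched_iff[OF rooted]
    by (auto simp: path_incident[OF walk distinct_nodes assms])
  finally show ?thesis .
qed

lemma incident_switch_off_path: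
  assumes "B \<in> \<N>" "B \<notin> set Us"
  shows "incident (sym_diff M (set es)) B = incident M B"
  using incident_off_walk[OF walk assms] by (simp add: incident_sym_diff)

lemma node_matching_switch: "node_matching \<N> F (sym_diff M (set es))"
proof (rule node_matchingI)
  show "sym_diff M (set es) \<subseteq> F"
    using walk node_matching_subset[OF matching_of_nodes] by (auto simp: walk_def)
  fix B assume B: "B \<in> \<N>"
  show "\<not> e \<subseteq> B" if "e \<in> sym_diff M (set es)" for e
    using that matched_not_inside[OF B] walk_edge_not_inside[OF walk _ B] by (auto simp: in_set_conv_nth)
  fix e f assume ef: "e \<in> incident (sym_diff M (set es)) B" "f \<in> incident (sym_diff M (set es)) B"
  show "e = f"
  proof (cases "B \<in> set Us")
    case True
    then obtain k where "k \<le> length es" "B = Us ! k"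
      using walk_length[OF walk] by (auto simp: in_set_conv_nth less_Suc_eq_le)
    then show ?thesis using ef by (auto simp: incident_switch_on_path)
  next
    case False
    then show ?thesis using ef incident_switch_off_path[OF B] matched_unique[OF B] by blast
  qed
qed

lemma uncovered_switchD:
  assumes "B \<in> \<N>" "uncovered (sym_diff M (set es)) B"
  shows "B \<notin> set Us \<and> uncovered M B \<or> even (length es) \<and> B = last Us"
proof (cases "B \<in> set Us")
  case True
  then obtain k where k: "k \<le> length es" "B = Us ! k"
    using walk_length[OF walk] by (auto simp: in_set_conv_nth less_Suc_eq_le)
  have none: "\<not> (i < length es \<and> even i \<and> (i = k \<or> Suc i = k))" for i
    using assms(2) incident_switch_on_path[OF k(1)] k(2) by (auto simp: uncovered_iff_incident_empty)
  have "even k" using none[of "k - 1"] k(1) by (cases k) auto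
  moreover have "k = length es" using none[of k] k(1) \<open>even k\<close> by auto
  ultimately show ?thesis using k walk_last[OF walk] by simp
qed (use assms incident_switch_off_path in \<open>simp add: uncovered_iff_incident_empty\<close>)

lemma near_perfect_matching_switch:
  assumes "near_perfect_matching \<N> F M" "even (length es)"
  shows "near_perfect_matching \<N> F (sym_diff M (set es))"
proof -
  have "hd Us \<in> set Us" using walk_length[OF walk] by (cases Us) auto
  moreover have "B = hd Us" if "B \<in> \<N>" "uncovered M B" for B
    using assms(1) that walk_hd_in[OF walk] rooted
    unfolding near_perfect_matching_def rooted_walk_def by blast
  ultimately have "B = last Us" if "B \<in> \<N>" "uncovered (sym_diff M (set es)) B" for B
    using uncovered_switchD[OF that] that(1) by blast
  then show ?thesis unfolding near_perfect_matching_def using node_matching_switch by metis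
qed

end

section \<open>Blossoms\<close>

locale blossom_walk = contracted_matching +
  fixes Us es i j
  assumes rooted: "rooted_walk Us es"
    and segment: "i < j" "j \<le> length es"
    and closed: "Us ! i = Us ! j"
    and odd_length: "odd (j - i)"
    and inj_nodes: "inj_on ((!) Us) {i..<j}"
begin

definition blossom_nodes :: "'a set set" where
  "blossom_nodes = (!) Us ` {i..<j}"

definition blossom_edges :: "'a set set" where
  "blossom_edges = (!) es ` {i..<j}"

lemmas walk = rooted_walk_walk[OF rooted]

lemma node_in: "k \<le> j \<Longrightarrow> Us ! k \<in> \<N>"
  using walk_node_in[OF walk] segment(2) by simp

lemma blossom_nodes_subset: "blossom_nodes \<subseteq> \<N>"
  using node_in by (auto simp: blossom_nodes_def)

lemma base_in_blossom_nodes: "Us ! i \<in> blossom_nodes"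
  using segment(1) by (simp add: blossom_nodes_def)

lemma segment_node_in_blossom_nodes:
  assumes "i \<le> k" "k \<le> j" shows "Us ! k \<in> blossom_nodes"
proof (cases "k = j")
  case True
  then show ?thesis using closed base_in_blossom_nodes by simp
qed (use assms in \<open>simp add: blossom_nodes_def\<close>)

lemma segment_node_eq_iff: "i \<le> k \<Longrightarrow> k < j \<Longrightarrow> i \<le> m \<Longrightarrow> m < j \<Longrightarrow> Us ! k = Us ! m \<longleftrightarrow> k = m"
  using inj_on_eq_iff[OF inj_nodes] by simp

lemma segment_longer_than_two: "Suc (Suc i) < j"
proof -
  have "j \<noteq> Suc i" using walk_edge_ends(1)[OF walk, of i] segment closed by auto
  moreover have "j \<noteq> Suc (Suc i)" using odd_length by auto
  ultimately show ?thesis using segment(1) by simp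
qed

text \<open>
  If the start were odd, then the first and the last edge of the segment would both be the matching
  edge at \<open>Us ! i\<close>.
\<close>

lemma even_start: "even i"
proof (rule ccontr)
  assume "odd i"
  define k where "k = j - 1"
  have k: "j = Suc k" "k < length es" "Suc i < k"
    using segment segment_longer_than_two by (auto simp: k_def)
  have "odd k" using odd_length \<open>odd i\<close> segment(1) k(1) by auto
  have "es ! i \<in> incident M (Us ! i)" "es ! k \<in> incident M (Us ! i)"
    using rooted_walk_edge_matched_iff[OF rooted, of i] rooted_walk_edge_matched_iff[OF rooted, of k]
      walk_edge_ends(2)[OF walk, of i] walk_edge_ends(3)[OF walk, of k] \<open>odd i\<close> \<open>odd k\<close> k closed
    by (simp_all add: incident_def)
  then have "es ! i = es ! k" using matched_unique node_in segment(1) by (meson less_imp_le)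
  then have "Us ! k = Us ! i \<or> Us ! k = Us ! Suc i"
    using walk_edge_meets_iff[OF walk _ node_in, of i k] walk_edge_ends(2)[OF walk k(2)] k by simp
  then show False using segment_node_eq_iff[of k i] segment_node_eq_iff[of k "Suc i"] k by simp
qed

lemma odd_end: "odd j"
  using even_start odd_length segment(1) by simp

lemma card_blossom_nodes: "card blossom_nodes = j - i"
  by (simp add: blossom_nodes_def card_image[OF inj_nodes])

lemma blossom_edges_inside: "blossom_edges \<subseteq> edges_inside F (\<Union> blossom_nodes)"
proof
  fix e assume "e \<in> blossom_edges"
  then obtain k where k: "i \<le> k" "k < j" "e = es ! k" by (auto simp: blossom_edges_def)
  have "Us ! k \<in> blossom_nodes" "Us ! Suc k \<in> blossom_nodes"
    using segment_node_in_blossom_nodes k by simp_all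
  then show "e \<in> edges_inside F (\<Union> blossom_nodes)"
    using walk_edge_subset[OF walk, of k] walk_edge_in[OF walk, of k] k segment(2)
    by (auto simp: edges_inside_def)
qed

lemma matched_inside_blossom_at_inner_node:
  assumes "i < k" "k < j"
  shows "incident M (Us ! k) \<noteq> {}" "incident M (Us ! k) \<subseteq> blossom_edges"
proof -
  have incident: "incident M (Us ! k) = {es ! m | m. m < length es \<and> odd m \<and> (m = k \<or> Suc m = k)}"
    using rooted_walk_incident[OF rooted] assms segment(2) by simp
  define m where "m = (if odd k then k else k - 1)"
  have "m < length es" "odd m" "m = k \<or> Suc m = k" using assms segment(2) by (auto simp: m_def)
  then show "incident M (Us ! k) \<noteq> {}" unfolding incident by blast
  show "incident M (Us ! k) \<subseteq> blossom_edges"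
    unfolding incident using assms by (auto simp: blossom_edges_def)
qed

lemma base_uncovered_inside_blossom: "uncovered (M \<inter> blossom_edges) (Us ! i)"
  unfolding uncovered_def
proof (rule ccontr)
  assume "\<not> (\<forall>e\<in>M \<inter> blossom_edges. e \<inter> Us ! i = {})"
  then obtain e where "e \<in> blossom_edges" "e \<in> M" "e \<inter> Us ! i \<noteq> {}" by blast
  then obtain k where k: "i \<le> k" "k < j" "es ! k \<in> M" "es ! k \<inter> Us ! i \<noteq> {}"
    unfolding blossom_edges_def by fastforce
  then have "odd k" using rooted_walk_edge_matched_iff[OF rooted] segment(2) by simp
  have "i < k" using k(1) even_start \<open>odd k\<close> by (cases "k = i") auto
  moreover have "Suc k < j" using k(2) odd_end \<open>odd k\<close> by (cases "Suc k = j") auto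
  moreover have "Us ! i = Us ! k \<or> Us ! i = Us ! Suc k"
    using walk_edge_meets_iff[OF walk _ node_in, of k i] k segment by simp
  ultimately show False using segment_node_eq_iff[of i k] segment_node_eq_iff[of i "Suc k"] by simp
qed

lemma uncovered_inside_blossom_iff:
  assumes "B \<in> blossom_nodes"
  shows "uncovered (M \<inter> blossom_edges) B \<longleftrightarrow> B = Us ! i"
proof
  obtain k where k: "i \<le> k" "k < j" "B = Us ! k" using assms by (auto simp: blossom_nodes_def)
  assume "uncovered (M \<inter> blossom_edges) B"
  then have "incident M (Us ! k) \<inter> blossom_edges = {}" using k by (auto simp: uncovered_def incident_def)
  then have "\<not> i < k" using matched_inside_blossom_at_inner_node[of k] k(2) by blast
  then show "B = Us ! i" using k by simp
qed (simp add: base_uncovered_inside_blossom)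

lemma near_perfect_blossom: "near_perfect_matching blossom_nodes blossom_edges (M \<inter> blossom_edges)"
  unfolding near_perfect_matching_def
  using node_matching_restrict[OF matching_of_nodes blossom_nodes_subset] uncovered_inside_blossom_iff
  by simp

lemma matched_outside_blossom_meets_base:
  assumes "e \<in> M" "e \<notin> blossom_edges"
  shows "e \<inter> \<Union> blossom_nodes \<subseteq> Us ! i"
proof
  fix v assume v: "v \<in> e \<inter> \<Union> blossom_nodes"
  then obtain k where k: "i \<le> k" "k < j" "v \<in> Us ! k" by (auto simp: blossom_nodes_def)
  then have "e \<in> incident M (Us ! k)" using v assms(1) by (auto simp: incident_def)
  then have "\<not> i < k" using matched_inside_blossom_at_inner_node(2) k(2) assms(2) by blast
  then show "v \<in> Us ! i" using k by simp
qed

lemma node_matching_contract: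
  "node_matching (insert (\<Union> blossom_nodes) (\<N> - blossom_nodes)) F (M - blossom_edges)"
proof (rule node_matchingI)
  let ?\<N> = "insert (\<Union> blossom_nodes) (\<N> - blossom_nodes)"
  show "M - blossom_edges \<subseteq> F" using node_matching_subset[OF matching_of_nodes] by blast
  have base: "Us ! i \<in> \<N>" using node_in segment(1) by simp
  have below: "\<exists>A\<in>\<N>. \<forall>e\<in>M - blossom_edges. e \<inter> B \<subseteq> A" if "B \<in> ?\<N>" for B
    using that base matched_outside_blossom_meets_base by blast
  fix B assume B: "B \<in> ?\<N>"
  then obtain A where A: "A \<in> \<N>" "\<And>e. e \<in> M - blossom_edges \<Longrightarrow> e \<inter> B \<subseteq> A" using below by meson
  show "\<not> e \<subseteq> B" if "e \<in> M - blossom_edges" for e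
    using matched_not_inside[OF A(1)] A(2)[OF that] that by blast
  show "e = f" if "e \<in> incident (M - blossom_edges) B" "f \<in> incident (M - blossom_edges) B" for e f
  proof (rule matched_unique[OF A(1)])
    show "e \<in> incident M A" "f \<in> incident M A"
      using that A(2)[of e] A(2)[of f] unfolding incident_def by blast+
  qed
qed

end

section \<open>Laminar families\<close>

definition children :: "'v set set \<Rightarrow> 'v set \<Rightarrow> 'v set set" where
  "children F U = maximal_sets {W\<in>F. W \<subset> U}"

lemma maximal_sets_subset: "maximal_sets F \<subseteq> F"
  by (auto simp: maximal_sets_def)

lemma maximal_setsD: "B \<in> maximal_sets F \<Longrightarrow> W \<in> F \<Longrightarrow> B \<subseteq> W \<Longrightarrow> W = B"
  by (auto simp: maximal_sets_def)

lemma childrenD: "W \<in> children F U \<Longrightarrow> W \<in> F \<and> W \<subset> U"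
  by (simp add: children_def maximal_sets_def)

lemma maximal_superset:
  assumes "finite F" "U \<in> F" obtains B where "B \<in> maximal_sets F" "U \<subseteq> B"
proof -
  obtain B where "B \<in> F" "U \<subseteq> B" "\<forall>W\<in>F. B \<subseteq> W \<longrightarrow> B = W" using finite_has_maximal2[OF assms] by auto
  then show thesis using that[of B] by (auto simp: maximal_sets_def psubset_eq)
qed

lemma child_superset:
  assumes "finite F" "W \<in> F" "W \<subset> U" obtains W' where "W' \<in> children F U" "W \<subseteq> W'"
  using maximal_superset[of "{W\<in>F. W \<subset> U}" W] assms unfolding children_def by auto

locale laminar_family =
  fixes F :: "'v set set"
  assumes finite: "finite F" and nonempty: "A \<in> F \<Longrightarrow> A \<noteq> {}"
    and nested: "A \<in> F \<Longrightarrow> B \<in> F \<Longrightarrow> A \<inter> B \<noteq> {} \<Longrightarrow> A \<subseteq> B \<or> B \<subseteq> A"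
begin

lemma laminar_subfamily: "F' \<subseteq> F \<Longrightarrow> laminar_family F'"
  using finite nonempty nested finite_subset by unfold_locales blast+

lemma disjoint_maximal_sets: "pairwise disjnt (maximal_sets F)"
proof (rule pairwiseI)
  fix A B assume "A \<in> maximal_sets F" "B \<in> maximal_sets F" "A \<noteq> B"
  then have "A \<in> F" "B \<in> F" "\<not> A \<subseteq> B" "\<not> B \<subseteq> A" by (auto simp: maximal_sets_def psubset_eq)
  then show "disjnt A B" using nested unfolding disjnt_def by blast
qed

lemma disjoint_children: "pairwise disjnt (children F U)"
  unfolding children_def by (intro laminar_family.disjoint_maximal_sets laminar_subfamily) auto

lemma subset_maximal_if_meets:
  assumes "B \<in> maximal_sets F" "U \<in> F" "U \<inter> B \<noteq> {}" shows "U \<subseteq> B"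
proof -
  have "U \<subseteq> B \<or> B \<subseteq> U" using nested[OF assms(2)] maximal_sets_subset assms(1,3) by blast
  then show ?thesis using maximal_setsD[OF assms(1,2)] by blast
qed

end

locale merged_laminar_family = laminar_family F for F :: "'v set set" +
  fixes P :: "'v set set"
  assumes merged_maximal: "P \<subseteq> maximal_sets F" and two_merged: "\<exists>A\<in>P. \<exists>B\<in>P. A \<noteq> B"
begin

lemma subset_merged_if_meets:
  assumes "W \<in> F" "W \<inter> \<Union> P \<noteq> {}" obtains A where "A \<in> P" "W \<subseteq> A"
proof -
  obtain A where "A \<in> P" "W \<inter> A \<noteq> {}" using assms(2) by blast
  then show thesis using that subset_maximal_if_meets[OF _ assms(1)] merged_maximal by blast
qed

lemma Union_nonempty: "\<Union> P \<noteq> {}"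
  using two_merged nonempty merged_maximal maximal_sets_subset by blast

lemma subset_Union_if_meets: "W \<in> F \<Longrightarrow> W \<inter> \<Union> P \<noteq> {} \<Longrightarrow> W \<subseteq> \<Union> P"
  using subset_merged_if_meets by blast

lemma not_Union_subset:
  assumes "W \<in> F" shows "\<not> \<Union> P \<subseteq> W"
proof
  assume sub: "\<Union> P \<subseteq> W"
  have "W = A" if "A \<in> P" for A
    using maximal_setsD[of A F W] that sub assms merged_maximal by blast
  then show False using two_merged by blast
qed

lemma Union_not_in_family: "\<Union> P \<notin> F"
  using not_Union_subset by blast

lemma laminar_insert_Union: "laminar_family (insert (\<Union> P) F)"
proof
  show "A \<noteq> {}" if "A \<in> insert (\<Union> P) F" for A using that nonempty Union_nonempty by blast
  show "A \<subseteq> B \<or> B \<subseteq> A" if "A \<in> insert (\<Union> P) F" "B \<in> insert (\<Union> P) F" "A \<inter> B \<noteq> {}" for A B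
    using that nested subset_Union_if_meets by blast
qed (simp add: finite)

lemma psubset_Union_iff:
  assumes "W \<in> F" shows "W \<subset> \<Union> P \<longleftrightarrow> (\<exists>A\<in>P. W \<subseteq> A)"
proof
  assume "W \<subset> \<Union> P"
  then have "W \<inter> \<Union> P \<noteq> {}" using nonempty[OF assms] by blast
  then show "\<exists>A\<in>P. W \<subseteq> A" using subset_merged_if_meets[OF assms] by blast
next
  assume "\<exists>A\<in>P. W \<subseteq> A"
  then show "W \<subset> \<Union> P" using Union_not_in_family assms by (metis Union_upper order_trans psubsetI)
qed

lemma maximal_psubset_Union_iff:
  assumes "B \<in> maximal_sets F" shows "B \<subset> \<Union> P \<longleftrightarrow> B \<in> P"
proof -
  have "B = A" if "A \<in> P" "B \<subseteq> A" for A
    using maximal_setsD[OF assms _ that(2)] that(1) merged_maximal maximal_sets_subset by blast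
  then show ?thesis using psubset_Union_iff assms maximal_sets_subset by (metis subsetD subset_refl)
qed

lemma maximal_sets_insert_Union: "maximal_sets (insert (\<Union> P) F) = insert (\<Union> P) (maximal_sets F - P)"
proof (rule set_eqI)
  fix B show "B \<in> maximal_sets (insert (\<Union> P) F) \<longleftrightarrow> B \<in> insert (\<Union> P) (maximal_sets F - P)"
  proof (cases "B = \<Union> P")
    case True
    then show ?thesis using not_Union_subset by (auto simp: maximal_sets_def)
  next
    case False
    then have "B \<in> maximal_sets (insert (\<Union> P) F) \<longleftrightarrow> B \<in> maximal_sets F \<and> \<not> B \<subset> \<Union> P"
      by (auto simp: maximal_sets_def)
    then show ?thesis using False maximal_psubset_Union_iff[of B] by auto
  qed
qed

lemma children_insert_Union: "children (insert (\<Union> P) F) (\<Union> P) = P"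
proof -
  have "W \<in> insert (\<Union> P) F \<and> W \<subset> \<Union> P \<longleftrightarrow> W \<in> F \<and> (\<exists>A\<in>P. W \<subseteq> A)" for W
    by (metis Union_not_in_family insert_iff psubset_Union_iff psubset_eq)
  then have "{W \<in> insert (\<Union> P) F. W \<subset> \<Union> P} = {W \<in> F. \<exists>A\<in>P. W \<subseteq> A}" by simp
  moreover have "maximal_sets {W \<in> F. \<exists>A\<in>P. W \<subseteq> A} = P"
  proof
    show "P \<subseteq> maximal_sets {W \<in> F. \<exists>A\<in>P. W \<subseteq> A}"
      using merged_maximal by (fastforce simp: maximal_sets_def)
    show "maximal_sets {W \<in> F. \<exists>A\<in>P. W \<subseteq> A} \<subseteq> P"
    proof
      fix B assume B: "B \<in> maximal_sets {W \<in> F. \<exists>A\<in>P. W \<subseteq> A}"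
      then obtain A where A: "A \<in> P" "B \<subseteq> A" using maximal_sets_subset by blast
      then have "A = B" using maximal_setsD[OF B _ A(2)] merged_maximal maximal_sets_subset by blast
      then show "B \<in> P" using A(1) by simp
    qed
  qed
  ultimately show ?thesis by (simp add: children_def)
qed

lemma children_insert_Union_member:
  assumes "U \<in> F" shows "children (insert (\<Union> P) F) U = children F U"
proof -
  have "{W \<in> insert (\<Union> P) F. W \<subset> U} = {W \<in> F. W \<subset> U}" using not_Union_subset[OF assms] by blast
  then show ?thesis by (simp add: children_def)
qed

end

context laminar_family
begin

lemma maximal_sets_Diff_subset:
  assumes "D \<subseteq> maximal_sets F"
  shows "maximal_sets (F - D) \<subseteq> (maximal_sets F - D) \<union> \<Union> (children F ` D)"
proof
  fix B assume "B \<in> maximal_sets (F - D)"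
  then have B: "B \<in> F" "B \<notin> D" and max: "\<And>W. W \<in> F - D \<Longrightarrow> B \<subseteq> W \<Longrightarrow> W = B"
    using maximal_sets_subset maximal_setsD by blast+
  obtain A where A: "A \<in> maximal_sets F" "B \<subseteq> A" using maximal_superset[OF finite B(1)] .
  show "B \<in> (maximal_sets F - D) \<union> \<Union> (children F ` D)"
  proof (cases "A \<in> D")
    case True
    then obtain W where W: "W \<in> children F A" "B \<subseteq> W"
      using child_superset[OF finite B(1), of A] A(2) B(2) by blast
    have "W \<notin> D" using childrenD[OF W(1)] maximal_setsD[of W F A] A(1) maximal_sets_subset assms by blast
    then have "W = B" using max[of W] W childrenD[OF W(1)] by blast
    then show ?thesis using W(1) True by blast
  next
    case False
    then have "A = B" using max[of A] A maximal_sets_subset by blast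
    then show ?thesis using A(1) False by blast
  qed
qed

lemma children_Diff:
  assumes "D \<subseteq> maximal_sets F" "U \<in> F" shows "children (F - D) U = children F U"
proof -
  have "{W \<in> F - D. W \<subset> U} = {W \<in> F. W \<subset> U}" using assms maximal_setsD[of _ F U] by blast
  then show ?thesis by (simp add: children_def)
qed

end

section \<open>The matching of a laminar family of blossoms\<close>

text \<open>
  The edge set \<open>T\<close> is later the set of tight edges. It is arbitrary here because a dual update changes the
  tight edges while leaving the blossoms and the matching as they are.
\<close>

locale blossom_structure =
  fixes V :: "'v set" and T :: "'v set set" and s :: "'v state"
  assumes graph: "simple_graph V T"
    and family_odd: "family s \<subseteq> odd_sets V"
    and singleton_in_family: "v \<in> V \<Longrightarrow> {v} \<in> family s"
    and family_nested: "A \<in> family s \<Longrightarrow> B \<in> family s \<Longrightarrow> A \<inter> B \<noteq> {} \<Longrightarrow> A \<subseteq> B \<or> B \<subseteq> A"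
    and cmatch_node_matching: "node_matching (nodes s) T (cmatch s)"
    and cycle_inside: "U \<in> blossoms s \<Longrightarrow> cycle s U \<subseteq> edges_inside T U"
    and near_near_perfect: "U \<in> blossoms s \<Longrightarrow>
          near_perfect_matching (cycle_nodes s U) (cycle s U) (near s U)"
    and crossing_edge_at_base: "U \<in> blossoms s \<Longrightarrow> e \<in> full_matching s \<Longrightarrow> \<not> e \<subseteq> U \<Longrightarrow>
          W \<in> cycle_nodes s U \<Longrightarrow> e \<inter> W \<noteq> {} \<Longrightarrow> uncovered (near s U) W"
begin

lemma finite_V: "finite V"
  using graph by (simp add: simple_graph_def)

lemma edge_card: "e \<in> T \<Longrightarrow> card e = 2"
  using graph by (simp add: simple_graph_def)

lemma family_member:
  assumes "U \<in> family s" shows "U \<subseteq> V" "odd (card U)" "finite U" "U \<noteq> {}"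
proof -
  show "U \<subseteq> V" "odd (card U)" using assms family_odd by (auto simp: odd_sets_def)
  then show "finite U" "U \<noteq> {}" using finite_V finite_subset by auto
qed

sublocale family: laminar_family "family s"
proof
  show "finite (family s)" using family_odd finite_odd_sets[OF finite_V] finite_subset by blast
qed (use family_member(4) family_nested in blast)+

sublocale contracted: contracted_matching "nodes s" T "cmatch s"
proof
  show "pairwise disjnt (nodes s)" unfolding nodes_def by (rule family.disjoint_maximal_sets)
qed (use edge_card cmatch_node_matching in auto)

lemma cycle_nodes_eq_children: "cycle_nodes s U = children (family s) U"
  by (simp add: cycle_nodes_def children_def)

lemma node_in_family: "B \<in> nodes s \<Longrightarrow> B \<in> family s"
  using maximal_sets_subset by (auto simp: nodes_def)

lemma blossom_in_family: "U \<in> blossoms s \<Longrightarrow> U \<in> family s"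
  by (simp add: blossoms_def)

lemma cycle_nodeD: "W \<in> cycle_nodes s U \<Longrightarrow> W \<in> family s \<and> W \<subset> U"
  unfolding cycle_nodes_eq_children by (rule childrenD)

lemma node_containing:
  assumes "v \<in> V" obtains B where "B \<in> nodes s" "v \<in> B"
  using maximal_superset[OF family.finite singleton_in_family[OF assms]] unfolding nodes_def by blast

lemma cycle_node_containing:
  assumes "U \<in> blossoms s" "v \<in> U" obtains W where "W \<in> cycle_nodes s U" "v \<in> W"
proof -
  have "v \<in> V" using family_member(1)[OF blossom_in_family] assms by blast
  moreover have "{v} \<subset> U" using assms by (auto simp: blossoms_def)
  ultimately show thesis
    using child_superset[OF family.finite singleton_in_family, of v U] that
    unfolding cycle_nodes_eq_children by blast
qed

lemma cycle_contracted_matching: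
  assumes "U \<in> blossoms s"
  shows "contracted_matching (cycle_nodes s U) (cycle s U) (near s U)"
proof
  show "pairwise disjnt (cycle_nodes s U)"
    unfolding cycle_nodes_eq_children by (rule family.disjoint_children)
  show "card e = 2" if "e \<in> cycle s U" for e
    using that cycle_inside[OF assms] edge_card by (auto simp: edges_inside_def)
qed (use near_near_perfect[OF assms] in \<open>simp add: near_perfect_matching_def\<close>)

lemma near_node_matching: "U \<in> blossoms s \<Longrightarrow> node_matching (cycle_nodes s U) (cycle s U) (near s U)"
  using near_near_perfect by (simp add: near_perfect_matching_def)

lemma near_edge:
  assumes "U \<in> blossoms s" "e \<in> near s U"
  shows "e \<in> T" "e \<subseteq> U" "e \<in> full_matching s"
proof -
  have "e \<in> edges_inside T U"
    using assms node_matching_subset[OF near_node_matching] cycle_inside by blast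
  then show "e \<in> T" "e \<subseteq> U" by (simp_all add: edges_inside_def)
  show "e \<in> full_matching s" using assms by (auto simp: full_matching_def)
qed

lemma cmatch_subset_full_matching: "cmatch s \<subseteq> full_matching s"
  by (auto simp: full_matching_def)

lemma full_matching_cases:
  assumes "e \<in> full_matching s"
  obtains (cmatch) "e \<in> cmatch s" | (near) U where "U \<in> blossoms s" "e \<in> near s U"
  using assms by (auto simp: full_matching_def)

lemma full_matching_subset: "full_matching s \<subseteq> T"
  using node_matching_subset[OF cmatch_node_matching] near_edge(1) by (auto simp: full_matching_def)

lemma cmatch_not_inside_member:
  assumes "e \<in> cmatch s" "U \<in> family s" shows "\<not> e \<subseteq> U"
proof -
  obtain B where "B \<in> nodes s" "U \<subseteq> B"
    using maximal_superset[OF family.finite assms(2)] unfolding nodes_def .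
  then show ?thesis using contracted.matched_not_inside assms(1) by blast
qed

lemma near_not_inside_member:
  assumes "U \<in> blossoms s" "e \<in> near s U" "W \<in> family s" "W \<subset> U" shows "\<not> e \<subseteq> W"
proof -
  obtain W' where "W' \<in> cycle_nodes s U" "W \<subseteq> W'"
    using child_superset[OF family.finite assms(3,4)] unfolding cycle_nodes_eq_children .
  then show ?thesis using node_matching_not_inside[OF near_node_matching] assms(1,2) by blast
qed

lemma near_edge_unique:
  assumes U: "U \<in> blossoms s" and f: "f \<in> near s U" and v: "v \<in> e" "v \<in> f"
    and e: "e \<in> near s U \<or> e \<in> full_matching s \<and> \<not> e \<subseteq> U"
  shows "e = f"
proof -
  obtain W where W: "W \<in> cycle_nodes s U" "v \<in> W"
    using cycle_node_containing[OF U] near_edge(2)[OF U f] v by blast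
  then have "f \<in> incident (near s U) W" using f v by (auto simp: incident_def)
  moreover from this have "e \<in> near s U"
    using e crossing_edge_at_base[OF U _ _ W(1)] v W(2) by (auto simp: uncovered_iff_incident_empty)
  then have "e \<in> incident (near s U) W" using v W(2) by (auto simp: incident_def)
  ultimately show ?thesis using node_matching_unique[OF near_node_matching[OF U] W(1)] by blast
qed

lemma full_matching_eq_near_edge:
  assumes U: "U \<in> blossoms s" "f \<in> near s U" and e: "e \<in> full_matching s" and v: "v \<in> e" "v \<in> f"
  shows "e = f"
  using e
proof (cases rule: full_matching_cases)
  case cmatch
  then show ?thesis
    using near_edge_unique[OF U v] cmatch_not_inside_member blossom_in_family[OF U(1)] e by blast
next
  case (near U')
  have "U \<inter> U' \<noteq> {}" using near_edge(2)[OF U] near_edge(2)[OF near] v by blast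
  then consider (same) "U' = U" | (above) "U \<subset> U'" | (below) "U' \<subset> U"
    using family_nested[OF blossom_in_family[OF U(1)] blossom_in_family[OF near(1)]] by blast
  then show ?thesis
  proof cases
    case same
    then show ?thesis using near_edge_unique[OF U v] near by blast
  next
    case above
    then have "\<not> e \<subseteq> U" using near_not_inside_member[OF near blossom_in_family[OF U(1)]] by blast
    then show ?thesis using near_edge_unique[OF U v] e by blast
  next
    case below
    then have "\<not> f \<subseteq> U'" using near_not_inside_member[OF U blossom_in_family[OF near(1)]] by blast
    then show ?thesis using near_edge_unique[OF near v(2,1)] near_edge(3)[OF U] by blast
  qed
qed

lemma full_matching_unique_at_vertex:
  assumes e: "e \<in> full_matching s" and f: "f \<in> full_matching s" and v: "v \<in> e" "v \<in> f"
  shows "e = f"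
  using f
proof (cases rule: full_matching_cases)
  case f_cmatch: cmatch
  show ?thesis
    using e
  proof (cases rule: full_matching_cases)
    case cmatch
    have "v \<in> V" using full_matching_subset e v(1) graph by (auto simp: simple_graph_def)
    then obtain B where "B \<in> nodes s" "v \<in> B" using node_containing by blast
    moreover from this have "e \<in> incident (cmatch s) B" "f \<in> incident (cmatch s) B"
      using cmatch f_cmatch v by (auto simp: incident_def)
    ultimately show ?thesis using contracted.matched_unique by blast
  next
    case (near U)
    then show ?thesis using full_matching_eq_near_edge[OF near f v(2,1)] by simp
  qed
next
  case (near U)
  then show ?thesis using full_matching_eq_near_edge[OF near e v] by simp
qed

lemma matching_full_matching: "matching T (full_matching s)"
  unfolding matching_def pairwise_def disjnt_def
  using full_matching_subset full_matching_unique_at_vertex by blast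

lemma near_perfect_inside_blossom:
  assumes U: "U \<in> blossoms s"
    and inner: "\<And>W. W \<in> cycle_nodes s U \<Longrightarrow> near_perfect_inside (full_matching s) W"
  shows "near_perfect_inside (full_matching s) U"
proof -
  let ?covered = "\<Union> (edges_inside (full_matching s) U)"
  have inside_U: "\<Union> (edges_inside (full_matching s) W) \<subseteq> ?covered" if "W \<in> cycle_nodes s U" for W
    using cycle_nodeD[OF that] by (auto simp: edges_inside_def)
  have matched_covered: "W \<subseteq> ?covered"
    if W: "W \<in> cycle_nodes s U" and matched: "\<not> uncovered (near s U) W" for W
  proof -
    obtain f where f: "f \<in> near s U" "f \<inter> W \<noteq> {}" using matched by (auto simp: uncovered_def)
    have "\<not> f \<subseteq> W" using near_not_inside_member[OF U f(1)] cycle_nodeD[OF W] by blast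
    then have "W \<subseteq> \<Union> (edges_inside (full_matching s) W) \<union> f"
      using near_perfect_inside_covered_by_crossing_edge[OF matching_full_matching inner[OF W]]
        near_edge(3)[OF U f(1)] f(2) by blast
    moreover have "f \<subseteq> ?covered" using near_edge[OF U f(1)] by (auto simp: edges_inside_def)
    ultimately show ?thesis using inside_U[OF W] by blast
  qed
  obtain z where z: "z \<in> U" "\<And>W. W \<in> cycle_nodes s U \<Longrightarrow> W - {z} \<subseteq> ?covered"
  proof (cases "\<exists>W\<in>cycle_nodes s U. uncovered (near s U) W")
    case True
    then obtain W0 where W0: "W0 \<in> cycle_nodes s U" "uncovered (near s U) W0" by blast
    obtain z where z: "z \<in> W0" "W0 - {z} \<subseteq> ?covered"
      using inner[OF W0(1)] inside_U[OF W0(1)] unfolding near_perfect_inside_def by blast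
    have "W - {z} \<subseteq> ?covered" if "W \<in> cycle_nodes s U" for W
    proof (cases "W = W0")
      case False
      then have "\<not> uncovered (near s U) W"
        using near_near_perfect[OF U] that W0 unfolding near_perfect_matching_def by blast
      then show ?thesis using matched_covered[OF that] by blast
    qed (use z(2) in simp)
    then show thesis using that[of z] z(1) cycle_nodeD[OF W0(1)] by blast
  next
    case False
    obtain z where "z \<in> U" using family_member(4)[OF blossom_in_family[OF U]] by blast
    then show thesis using that[of z] False matched_covered by blast
  qed
  then have "U - {z} \<subseteq> ?covered" using cycle_node_containing[OF U] by blast
  then show ?thesis unfolding near_perfect_inside_def using z(1) by blast
qed

lemma near_perfect_inside_member: "U \<in> family s \<Longrightarrow> near_perfect_inside (full_matching s) U"
proof (induction "card U" arbitrary: U rule: less_induct)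
  case less
  note U = family_member[OF less.prems]
  show ?case
  proof (cases "3 \<le> card U")
    case False
    then have "card U = 1" using U(2) by presburger
    then obtain z where "U = {z}" by (auto simp: card_1_singleton_iff)
    then show ?thesis by (simp add: near_perfect_inside_def)
  next
    case True
    then have "U \<in> blossoms s" using less.prems by (simp add: blossoms_def)
    moreover have "near_perfect_inside (full_matching s) W" if "W \<in> cycle_nodes s U" for W
      using less.hyps[of W] cycle_nodeD[OF that] psubset_card_mono[OF U(3)] by blast
    ultimately show ?thesis by (rule near_perfect_inside_blossom)
  qed
qed

lemma node_uncovered_if_vertex_uncovered:
  assumes "B \<in> nodes s" "v \<in> B" "v \<notin> \<Union> (full_matching s)"
  shows "uncovered (cmatch s) B"
  unfolding uncovered_def
proof (rule ballI, rule ccontr)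
  fix f assume f: "f \<in> cmatch s" "f \<inter> B \<noteq> {}"
  have "\<not> f \<subseteq> B" using f(1) assms(1) by (rule contracted.matched_not_inside[rotated])
  then have "B \<subseteq> \<Union> (edges_inside (full_matching s) B) \<union> f"
    using near_perfect_inside_covered_by_crossing_edge[OF matching_full_matching near_perfect_inside_member]
      node_in_family[OF assms(1)] f cmatch_subset_full_matching by blast
  then show False using assms(2,3) f(1) cmatch_subset_full_matching by (auto simp: edges_inside_def)
qed

lemma blossom_structure_change_edges:
  assumes "simple_graph V T'" "cmatch s \<subseteq> T'" "\<And>U. U \<in> blossoms s \<Longrightarrow> cycle s U \<subseteq> T'"
  shows "blossom_structure V T' s"
proof
  show "node_matching (nodes s) T' (cmatch s)"
    using node_matching_restrict[OF cmatch_node_matching] assms(2) by blast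
  show "cycle s U \<subseteq> edges_inside T' U" if "U \<in> blossoms s" for U
    using cycle_inside[OF that] assms(3)[OF that] by (auto simp: edges_inside_def)
qed (use assms(1) family_odd singleton_in_family family_nested near_near_perfect
      crossing_edge_at_base in auto)

end

section \<open>Augmenting, shrinking and deshrinking\<close>

locale augmentation = blossom_structure V T s for V :: "'v set" and T s +
  fixes Us es N and s' :: "'v state"
  assumes rooted: "contracted.rooted_walk Us es" and distinct_nodes: "distinct Us"
    and nontrivial: "es \<noteq> []" and end_uncovered: "uncovered (cmatch s) (last Us)"
    and augmented_state: "s' = s\<lparr>cmatch := sym_diff (cmatch s) (set es), near := N\<rparr>"
    and near_switched: "U \<in> blossoms s \<Longrightarrow> \<exists>B\<in>set Us. U \<subseteq> B \<Longrightarrow>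
          \<exists>Q. even_cycle_path s U Q \<and> N U = sym_diff (near s U) Q"
    and near_unchanged: "U \<in> blossoms s \<Longrightarrow> \<not> (\<exists>B\<in>set Us. U \<subseteq> B) \<Longrightarrow> N U = near s U"
    and augmented_cut_edge_at_base: "U \<in> blossoms s \<Longrightarrow> e \<in> full_matching s' \<inter> cut T U \<Longrightarrow>
          W \<in> cycle_nodes s U \<Longrightarrow> e \<inter> W \<noteq> {} \<Longrightarrow> uncovered (N U) W"
begin

sublocale switching: switching_path "nodes s" T "cmatch s" Us es
  by unfold_locales (use rooted distinct_nodes end_uncovered in auto)

lemma augmented_simps:
  "family s' = family s" "nodes s' = nodes s" "blossoms s' = blossoms s" "cycle_nodes s' = cycle_nodes s"
  "cycle s' = cycle s" "near s' = N" "cmatch s' = sym_diff (cmatch s) (set es)"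
  by (auto simp: augmented_state nodes_def blossoms_def cycle_nodes_def fun_eq_iff)

lemma near_perfect_augmented:
  assumes U: "U \<in> blossoms s"
  shows "near_perfect_matching (cycle_nodes s U) (cycle s U) (N U)"
proof (cases "\<exists>B\<in>set Us. U \<subseteq> B")
  case True
  then obtain Q where Q: "even_cycle_path s U Q" and N: "N U = sym_diff (near s U) Q"
    using near_switched U by blast
  interpret cycle: contracted_matching "cycle_nodes s U" "cycle s U" "near s U"
    by (rule cycle_contracted_matching[OF U])
  obtain Ws fs where path: "cycle.rooted_walk Ws fs" "distinct Ws" "even (length fs)" "Q = set fs"
    using Q unfolding even_cycle_path_def cycle.rooted_walk_def by blast
  interpret switching_path "cycle_nodes s U" "cycle s U" "near s U" Ws fs
    by unfold_locales (use path in auto)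
  show ?thesis using near_perfect_matching_switch[OF near_near_perfect[OF U] path(3)] N path(4) by simp
next
  case False
  then show ?thesis using near_near_perfect[OF U] near_unchanged[OF U] by simp
qed

lemma full_matching_augmented_subset: "full_matching s' \<subseteq> T"
proof -
  have "cmatch s' \<subseteq> T"
    using node_matching_subset[OF switching.node_matching_switch] by (simp add: augmented_simps)
  moreover have "N U \<subseteq> T" if "U \<in> blossoms s" for U
  proof -
    have "N U \<subseteq> cycle s U"
      using near_perfect_augmented[OF that] node_matching_subset by (auto simp: near_perfect_matching_def)
    then show ?thesis using cycle_inside[OF that] by (auto simp: edges_inside_def)
  qed
  ultimately show ?thesis by (auto simp: full_matching_def augmented_simps)
qed

lemma blossom_structure_augmented: "blossom_structure V T s'"
proof
  show "node_matching (nodes s') T (cmatch s')"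
    using switching.node_matching_switch by (simp add: augmented_simps)
  fix U assume "U \<in> blossoms s'"
  then have U: "U \<in> blossoms s" by (simp add: augmented_simps)
  show "cycle s' U \<subseteq> edges_inside T U" using cycle_inside[OF U] by (simp add: augmented_simps)
  show "near_perfect_matching (cycle_nodes s' U) (cycle s' U) (near s' U)"
    using near_perfect_augmented[OF U] by (simp add: augmented_simps)
  show "uncovered (near s' U) W"
    if "e \<in> full_matching s'" "\<not> e \<subseteq> U" "W \<in> cycle_nodes s' U" "e \<inter> W \<noteq> {}" for e W
  proof -
    have W: "W \<in> cycle_nodes s U" using that(3) by (simp add: augmented_simps)
    then have "e \<inter> U \<noteq> {}" using that(4) cycle_nodeD by blast
    then have "e \<in> full_matching s' \<inter> cut T U"
      using that(1,2) full_matching_augmented_subset card_edge_Int_eq_1_if_crossing edge_card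
      by (auto simp: cut_def)
    then show ?thesis using augmented_cut_edge_at_base[OF U _ W that(4)] by (simp add: augmented_simps)
  qed
qed (use graph family_odd singleton_in_family family_nested in \<open>auto simp: augmented_simps\<close>)

lemma covered_vertices_augmented: "\<Union> (full_matching s) \<subseteq> \<Union> (full_matching s')"
proof
  interpret augmented: blossom_structure V T s' by (rule blossom_structure_augmented)
  fix v assume "v \<in> \<Union> (full_matching s)"
  then obtain e where e: "e \<in> full_matching s" "v \<in> e" by blast
  show "v \<in> \<Union> (full_matching s')"
  proof (rule ccontr)
    assume v: "v \<notin> \<Union> (full_matching s')"
    have "v \<in> V" using e full_matching_subset graph by (auto simp: simple_graph_def)
    then obtain B where B: "B \<in> nodes s" "v \<in> B" by (rule node_containing)
    then have "uncovered (cmatch s') B"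
      using augmented.node_uncovered_if_vertex_uncovered v by (simp add: augmented_simps)
    then have off_path: "B \<notin> set Us" "uncovered (cmatch s) B"
      using switching.uncovered_switchD[OF B(1)]
        contracted.rooted_walk_to_uncovered_odd[OF rooted nontrivial end_uncovered]
      by (simp_all add: augmented_simps)
    from e(1) show False
    proof (cases rule: full_matching_cases)
      case cmatch
      then show False using off_path(2) e(2) B(2) by (auto simp: uncovered_def)
    next
      case (near U)
      then have "U \<inter> B \<noteq> {}" using near_edge(2) e(2) B(2) by blast
      then have "U \<subseteq> B"
        using family.subset_maximal_if_meets blossom_in_family[OF near(1)] B(1) by (simp add: nodes_def)
      moreover have "A = B" if "A \<in> set Us" "U \<subseteq> A" for A
      proof (rule contracted.node_eqI[OF _ B(1)])
        show "A \<in> nodes s" using that(1) switching.walk by (auto simp: walk_def)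
        show "A \<inter> B \<noteq> {}" using that(2) \<open>U \<inter> B \<noteq> {}\<close> by blast
      qed
      ultimately have "N U = near s U" using near_unchanged[OF near(1)] off_path(1) by blast
      then have "e \<in> full_matching s'" using near by (auto simp: full_matching_def augmented_simps)
      then show False using v e(2) by blast
    qed
  qed
qed

end

locale shrinking = blossom_structure V T s + blossom: blossom_walk "nodes s" T "cmatch s" Us es i j
  for V :: "'v set" and T s Us es i j +
  fixes U and s' :: "'v state"
  assumes U_eq_Union: "U = \<Union> blossom.blossom_nodes"
    and shrunk_state: "s' = s\<lparr>family := insert U (family s), dual := (dual s)(U := 0),
          cmatch := cmatch s - blossom.blossom_edges,
          cycle := (cycle s)(U := blossom.blossom_edges),
          near := (near s)(U := cmatch s \<inter> blossom.blossom_edges)\<rparr>"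
begin

sublocale merged: merged_laminar_family "family s" blossom.blossom_nodes
proof
  show "blossom.blossom_nodes \<subseteq> maximal_sets (family s)"
    using blossom.blossom_nodes_subset by (simp add: nodes_def)
  have "Us ! Suc i \<in> blossom.blossom_nodes"
    using blossom.segment_node_in_blossom_nodes[of "Suc i"] blossom.segment by simp
  moreover have "Us ! i \<noteq> Us ! Suc i" using walk_edge_ends(1)[OF blossom.walk] blossom.segment by simp
  ultimately show "\<exists>A\<in>blossom.blossom_nodes. \<exists>B\<in>blossom.blossom_nodes. A \<noteq> B"
    using blossom.base_in_blossom_nodes by blast
qed

lemma U_not_in_family: "U \<notin> family s"
  using merged.Union_not_in_family by (simp add: U_eq_Union)

lemma U_in_odd_sets: "U \<in> odd_sets V"
proof -
  have member: "A \<in> family s" if "A \<in> blossom.blossom_nodes" for A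
    using that blossom.blossom_nodes_subset node_in_family by blast
  have "odd (card U)"
    unfolding U_eq_Union
  proof (subst odd_card_Union_iff)
    show "finite blossom.blossom_nodes" by (simp add: blossom.blossom_nodes_def)
    show "pairwise disjnt blossom.blossom_nodes"
      by (rule pairwise_subset[OF contracted.nodes_disjoint blossom.blossom_nodes_subset])
    show "odd (card blossom.blossom_nodes)"
      using blossom.odd_length by (simp add: blossom.card_blossom_nodes)
    show "odd (card A)" if "A \<in> blossom.blossom_nodes" for A using family_member(2) member[OF that] .
  qed
  moreover have "U \<subseteq> V" unfolding U_eq_Union using family_member(1)[OF member] by (rule Union_least)
  ultimately show ?thesis by (simp add: odd_sets_def)
qed

lemma card_U_ge_3: "3 \<le> card U"
proof -
  have "card U \<noteq> 1"
  proof
    assume "card U = 1"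
    then obtain v where "U = {v}" by (auto simp: card_1_singleton_iff)
    then show False using singleton_in_family U_not_in_family U_in_odd_sets by (auto simp: odd_sets_def)
  qed
  moreover have "odd (card U)" using U_in_odd_sets by (simp add: odd_sets_def)
  ultimately show ?thesis by presburger
qed

lemma shrunk_simps:
  "family s' = insert U (family s)" "dual s' = (dual s)(U := 0)"
  "cmatch s' = cmatch s - blossom.blossom_edges" "cycle s' = (cycle s)(U := blossom.blossom_edges)"
  "near s' = (near s)(U := cmatch s \<inter> blossom.blossom_edges)" "blossoms s' = insert U (blossoms s)"
  "nodes s' = insert U (nodes s - blossom.blossom_nodes)" "cycle_nodes s' U = blossom.blossom_nodes"
proof -
  show "family s' = insert U (family s)" "dual s' = (dual s)(U := 0)"
    "cmatch s' = cmatch s - blossom.blossom_edges" "cycle s' = (cycle s)(U := blossom.blossom_edges)"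
    "near s' = (near s)(U := cmatch s \<inter> blossom.blossom_edges)" "blossoms s' = insert U (blossoms s)"
    using card_U_ge_3 by (auto simp: shrunk_state blossoms_def)
  show "nodes s' = insert U (nodes s - blossom.blossom_nodes)"
    using merged.maximal_sets_insert_Union by (simp add: shrunk_state nodes_def U_eq_Union)
  show "cycle_nodes s' U = blossom.blossom_nodes"
    using merged.children_insert_Union by (simp add: shrunk_state cycle_nodes_def children_def U_eq_Union)
qed

lemma old_blossom:
  assumes "W \<in> blossoms s"
  shows "W \<noteq> U" "cycle_nodes s' W = cycle_nodes s W"
proof -
  show "W \<noteq> U" using assms U_not_in_family blossom_in_family by blast
  show "cycle_nodes s' W = cycle_nodes s W"
    using merged.children_insert_Union_member[OF blossom_in_family[OF assms]]
    by (simp add: shrunk_state cycle_nodes_def children_def U_eq_Union)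
qed

lemma full_matching_shrunk: "full_matching s' = full_matching s"
proof -
  have "\<Union> (near s' ` blossoms s) = \<Union> (near s ` blossoms s)"
    using old_blossom(1) by (auto simp: shrunk_simps)
  then show ?thesis unfolding full_matching_def shrunk_simps(3,6) by (auto simp: shrunk_simps(5))
qed

lemma crossing_edge_at_new_base:
  assumes e: "e \<in> full_matching s" "\<not> e \<subseteq> U" and W: "W \<in> blossom.blossom_nodes" "e \<inter> W \<noteq> {}"
  shows "uncovered (cmatch s \<inter> blossom.blossom_edges) W"
proof -
  have "e \<in> cmatch s"
    using e(1)
  proof (cases rule: full_matching_cases)
    case (near W')
    have "W' \<inter> U \<noteq> {}" using near_edge(2)[OF near] W unfolding U_eq_Union by blast
    then have "e \<subseteq> U"
      using merged.subset_Union_if_meets[OF blossom_in_family[OF near(1)]] near_edge(2)[OF near]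
      by (simp add: U_eq_Union)
    then show ?thesis using e(2) by simp
  qed simp
  moreover have "e \<notin> blossom.blossom_edges"
    using blossom.blossom_edges_inside e(2) by (auto simp: edges_inside_def U_eq_Union)
  ultimately have "e \<inter> U \<subseteq> Us ! i"
    using blossom.matched_outside_blossom_meets_base by (simp add: U_eq_Union)
  then have "W \<inter> Us ! i \<noteq> {}" using W by (auto simp: U_eq_Union)
  then have "W = Us ! i"
    using contracted.node_eqI blossom.blossom_nodes_subset blossom.base_in_blossom_nodes W(1) by blast
  then show ?thesis using blossom.base_uncovered_inside_blossom by simp
qed

lemma blossom_structure_shrunk: "blossom_structure V T s'"
proof
  show "family s' \<subseteq> odd_sets V" using family_odd U_in_odd_sets by (simp add: shrunk_simps)
  show "{v} \<in> family s'" if "v \<in> V" for v using singleton_in_family[OF that] by (simp add: shrunk_simps)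
  show "A \<subseteq> B \<or> B \<subseteq> A" if "A \<in> family s'" "B \<in> family s'" "A \<inter> B \<noteq> {}" for A B
    using laminar_family.nested[OF merged.laminar_insert_Union] that by (simp add: shrunk_simps U_eq_Union)
  show "node_matching (nodes s') T (cmatch s')"
    using blossom.node_matching_contract by (simp add: shrunk_simps U_eq_Union)
  fix W assume "W \<in> blossoms s'"
  then consider "W = U" | "W \<in> blossoms s" by (auto simp: shrunk_simps)
  note W_cases = this
  show "cycle s' W \<subseteq> edges_inside T W"
    by (cases rule: W_cases)
      (use blossom.blossom_edges_inside cycle_inside old_blossom(1) in \<open>auto simp: shrunk_simps U_eq_Union\<close>)
  show "near_perfect_matching (cycle_nodes s' W) (cycle s' W) (near s' W)"
    by (cases rule: W_cases)
      (use blossom.near_perfect_blossom near_near_perfect old_blossom in \<open>auto simp: shrunk_simps\<close>)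
  show "uncovered (near s' W) B"
    if "e \<in> full_matching s'" "\<not> e \<subseteq> W" "B \<in> cycle_nodes s' W" "e \<inter> B \<noteq> {}" for e B
    by (cases rule: W_cases)
      (use that crossing_edge_at_new_base crossing_edge_at_base old_blossom in
        \<open>auto simp: shrunk_simps full_matching_shrunk\<close>)
qed (rule graph)

end

locale deshrinking = blossom_structure V T s for V :: "'v set" and T s +
  fixes D y and s' :: "'v state"
  assumes deshrunk_blossoms: "D \<subseteq> nodes s \<inter> blossoms s"
    and deshrunk_state: "s' = s\<lparr>family := family s - D, dual := y, cmatch := cmatch s \<union> \<Union> (near s ` D)\<rparr>"
begin

lemma deshrunk_simps:
  "family s' = family s - D" "cmatch s' = cmatch s \<union> \<Union> (near s ` D)" "cycle s' = cycle s"
  "near s' = near s" "blossoms s' = blossoms s - D"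
  by (auto simp: deshrunk_state blossoms_def)

lemma deshrunk_maximal: "D \<subseteq> maximal_sets (family s)"
  using deshrunk_blossoms by (simp add: nodes_def)

lemma cycle_nodes_deshrunk: "U \<in> blossoms s \<Longrightarrow> cycle_nodes s' U = cycle_nodes s U"
  using family.children_Diff[OF deshrunk_maximal blossom_in_family]
  by (simp add: deshrunk_state cycle_nodes_def children_def)

lemma nodes_deshrunk: "nodes s' \<subseteq> (nodes s - D) \<union> \<Union> (cycle_nodes s ` D)"
  using family.maximal_sets_Diff_subset[OF deshrunk_maximal]
  by (simp add: deshrunk_state nodes_def cycle_nodes_eq_children)

lemma full_matching_deshrunk: "full_matching s' = full_matching s"
  using deshrunk_blossoms by (auto simp: full_matching_def deshrunk_simps)

lemma new_cmatch_edgeE: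
  assumes "e \<in> cmatch s'" "e \<notin> cmatch s"
  obtains U where "U \<in> D" "U \<in> nodes s" "U \<in> blossoms s" "e \<in> near s U"
  using assms deshrunk_blossoms by (auto simp: deshrunk_simps)

lemma incident_deshrunk_node:
  assumes "B \<in> nodes s - D" shows "incident (cmatch s') B \<subseteq> incident (cmatch s) B"
proof
  fix e assume e: "e \<in> incident (cmatch s') B"
  have "e \<in> cmatch s"
  proof (rule ccontr)
    assume "e \<notin> cmatch s"
    then obtain U where U: "U \<in> D" "U \<in> nodes s" "U \<in> blossoms s" "e \<in> near s U"
      using new_cmatch_edgeE e by (auto simp: incident_def)
    then have "U \<inter> B \<noteq> {}" using near_edge(2) e by (auto simp: incident_def)
    then show False using contracted.node_eqI U assms by blast
  qed
  then show "e \<in> incident (cmatch s) B" using e by (simp add: incident_def)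
qed

lemma incident_deshrunk_cycle_node:
  assumes U: "U \<in> D" and B: "B \<in> cycle_nodes s U"
  shows "incident (cmatch s') B \<subseteq> incident (cmatch s) U \<or> incident (cmatch s') B \<subseteq> incident (near s U) B"
proof -
  have U_node: "U \<in> nodes s" "U \<in> blossoms s" using U deshrunk_blossoms by blast+
  have BU: "B \<subseteq> U" using cycle_nodeD[OF B] by blast
  have near: "e \<in> incident (near s U) B" if e: "e \<in> incident (cmatch s') B" "e \<notin> cmatch s" for e
  proof -
    obtain W where W: "W \<in> nodes s" "W \<in> blossoms s" "e \<in> near s W"
      using new_cmatch_edgeE e by (auto simp: incident_def)
    have "W \<inter> U \<noteq> {}" using near_edge(2)[OF W(2,3)] e(1) BU by (auto simp: incident_def)
    then show ?thesis using contracted.node_eqI[OF W(1) U_node(1)] W(3) e(1) by (simp add: incident_def)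
  qed
  show ?thesis
  proof (cases "uncovered (near s U) B")
    case True
    then have "e \<in> incident (cmatch s) U" if "e \<in> incident (cmatch s') B" for e
      using near[OF that] that BU by (auto simp: uncovered_iff_incident_empty incident_def)
    then show ?thesis by blast
  next
    case False
    have "e \<notin> cmatch s" if "e \<in> incident (cmatch s') B" for e
    proof
      assume "e \<in> cmatch s"
      then have "e \<in> full_matching s" "\<not> e \<subseteq> U"
        using cmatch_subset_full_matching cmatch_not_inside_member blossom_in_family[OF U_node(2)] by blast+
      then show False using crossing_edge_at_base[OF U_node(2) _ _ B] that False unfolding incident_def by blast
    qed
    then show ?thesis using near by blast
  qed
qed

lemma node_matching_deshrunk: "node_matching (nodes s') T (cmatch s')"
proof (rule node_matchingI)
  show "cmatch s' \<subseteq> T"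
    using full_matching_subset full_matching_deshrunk by (auto simp: full_matching_def)
  fix B assume B: "B \<in> nodes s'"
  then have B_member: "B \<in> family s" "B \<notin> D"
    using maximal_sets_subset by (auto simp: nodes_def deshrunk_simps)
  show "\<not> e \<subseteq> B" if e: "e \<in> cmatch s'" for e
  proof (cases "e \<in> cmatch s")
    case False
    then obtain U where U: "U \<in> D" "U \<in> nodes s" "U \<in> blossoms s" "e \<in> near s U"
      using new_cmatch_edgeE e by blast
    show ?thesis
    proof
      assume "e \<subseteq> B"
      moreover have "e \<noteq> {}" using edge_card[OF near_edge(1)[OF U(3,4)]] by auto
      ultimately have "B \<inter> U \<noteq> {}" using near_edge(2)[OF U(3,4)] by blast
      then have "B \<subset> U"
        using family.subset_maximal_if_meets[of U B] B_member U(1,2) by (auto simp: nodes_def)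
      then show False using near_not_inside_member[OF U(3,4) B_member(1)] \<open>e \<subseteq> B\<close> by blast
    qed
  qed (rule cmatch_not_inside_member[OF _ B_member(1)])
  show "e = f" if ef: "e \<in> incident (cmatch s') B" "f \<in> incident (cmatch s') B" for e f
  proof (cases "B \<in> nodes s - D")
    case True
    then show ?thesis using incident_deshrunk_node[OF True] ef contracted.matched_unique[of B] by blast
  next
    case False
    then obtain U where U: "U \<in> D" "B \<in> cycle_nodes s U" using B nodes_deshrunk by blast
    then have "U \<in> nodes s" "U \<in> blossoms s" using deshrunk_blossoms by blast+
    then show ?thesis
      using incident_deshrunk_cycle_node[OF U] ef contracted.matched_unique[of U]
        node_matching_unique[OF near_node_matching U(2)] by blast
  qed
qed

lemma blossom_structure_deshrunk: "blossom_structure V T s'"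
proof
  show "{v} \<in> family s'" if "v \<in> V" for v
    using singleton_in_family[OF that] deshrunk_blossoms by (auto simp: deshrunk_simps blossoms_def)
  show "node_matching (nodes s') T (cmatch s')" by (rule node_matching_deshrunk)
  fix U assume "U \<in> blossoms s'"
  then have U: "U \<in> blossoms s" by (simp add: deshrunk_simps)
  show "near_perfect_matching (cycle_nodes s' U) (cycle s' U) (near s' U)"
    using near_near_perfect[OF U] cycle_nodes_deshrunk[OF U] by (simp add: deshrunk_simps)
  show "uncovered (near s' U) W"
    if "e \<in> full_matching s'" "\<not> e \<subseteq> U" "W \<in> cycle_nodes s' U" "e \<inter> W \<noteq> {}" for e W
    using crossing_edge_at_base[OF U] that cycle_nodes_deshrunk[OF U] full_matching_deshrunk
    by (simp add: deshrunk_simps)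
qed (use graph family_odd family_nested cycle_inside in \<open>auto simp: deshrunk_simps\<close>)

end

section \<open>Weak duality for matchings of fixed cardinality\<close>

definition dual_above :: "'v set \<Rightarrow> ('v set \<Rightarrow> real) \<Rightarrow> 'v set \<Rightarrow> real" where
  "dual_above V y A = (\<Sum>U | U \<in> odd_sets V \<and> A \<subseteq> U. y U)"

abbreviation vertex_potential :: "'v set \<Rightarrow> ('v set \<Rightarrow> real) \<Rightarrow> 'v \<Rightarrow> real" where
  "vertex_potential V y v \<equiv> dual_above V y {v}"

definition exposed_potential_maximal :: "'v set \<Rightarrow> ('v set \<Rightarrow> real) \<Rightarrow> 'v set set \<Rightarrow> bool" where
  "exposed_potential_maximal V y M \<longleftrightarrow>
     (\<forall>u\<in>V. \<forall>v\<in>V - \<Union> M. vertex_potential V y u \<le> vertex_potential V y v)"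

lemma dual_above_diff: "dual_above V (\<lambda>U. y U - z U) A = dual_above V y A - dual_above V z A"
  by (simp add: dual_above_def sum_subtractf)

lemma dual_load_diff: "dual_load V E (\<lambda>U. y U - z U) e = dual_load V E y e - dual_load V E z e"
  by (simp add: dual_load_def sum_subtractf)

lemma dual_load_eq_potentials:
  assumes graph: "simple_graph V E" and e: "e \<in> E"
  shows "dual_load V E y e = (\<Sum>v\<in>e. vertex_potential V y v) - 2 * dual_above V y e"
proof -
  have fin: "finite (odd_sets V)" using graph finite_odd_sets by (auto simp: simple_graph_def)
  obtain a b where e_eq: "e = {a, b}" "a \<noteq> b" using graph e by (auto simp: simple_graph_def card_2_iff)
  have above: "dual_above V y A = (\<Sum>U\<in>odd_sets V. if A \<subseteq> U then y U else 0)" for A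
    unfolding dual_above_def using fin by (simp add: sum.inter_filter)
  have load: "dual_load V E y e = (\<Sum>U\<in>odd_sets V. if card (e \<inter> U) = 1 then y U else 0)"
    unfolding dual_load_def cut_def using fin e by (simp add: sum.inter_filter)
  have "(if card (e \<inter> U) = 1 then y U else 0) =
        (if {a} \<subseteq> U then y U else 0) + (if {b} \<subseteq> U then y U else 0) -
        2 * (if e \<subseteq> U then y U else 0)" for U
    using e_eq by (cases "a \<in> U"; cases "b \<in> U") auto
  then show ?thesis
    unfolding load using e_eq by (simp add: above sum.distrib sum_subtractf sum_distrib_left)
qed

lemma sum_dual_above_edges:
  assumes "finite V" "finite N"
  shows "(\<Sum>e\<in>N. dual_above V y e) = (\<Sum>U\<in>odd_sets V. y U * card (edges_inside N U))"
proof -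
  have "(\<Sum>e\<in>N. dual_above V y e) = (\<Sum>e\<in>N. \<Sum>U\<in>odd_sets V. if e \<subseteq> U then y U else 0)"
    using finite_odd_sets[OF assms(1)] by (simp add: dual_above_def sum.inter_filter)
  also have "\<dots> = (\<Sum>U\<in>odd_sets V. \<Sum>e\<in>N. if e \<subseteq> U then y U else 0)" by (rule sum.swap)
  also have "\<dots> = (\<Sum>U\<in>odd_sets V. y U * card (edges_inside N U))"
    using assms(2) by (intro sum.cong) (auto simp: edges_inside_def sum.inter_filter[symmetric] mult.commute)
  finally show ?thesis .
qed

lemma sum_dual_load_matching:
  assumes graph: "simple_graph V E" and N: "matching E N"
  shows "(\<Sum>e\<in>N. dual_load V E y e) =
         (\<Sum>v\<in>\<Union> N. vertex_potential V y v) - 2 * (\<Sum>U\<in>odd_sets V. y U * card (edges_inside N U))"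
proof -
  have "(\<Sum>e\<in>N. dual_load V E y e) = (\<Sum>e\<in>N. (\<Sum>v\<in>e. vertex_potential V y v) - 2 * dual_above V y e)"
    by (intro sum.cong refl dual_load_eq_potentials[OF graph] matching_edge(1)[OF graph N])
  also have "\<dots> = (\<Sum>e\<in>N. \<Sum>v\<in>e. vertex_potential V y v) - 2 * (\<Sum>e\<in>N. dual_above V y e)"
    by (simp add: sum_subtractf sum_distrib_left)
  also have "(\<Sum>e\<in>N. \<Sum>v\<in>e. vertex_potential V y v) = (\<Sum>v\<in>\<Union> N. vertex_potential V y v)"
    using sum.Union_disjoint[of N "vertex_potential V y"] matching_edge(4)[OF graph N]
      matching_disjoint[OF N] by simp
  finally show ?thesis
    using sum_dual_above_edges[OF _ finite_matching[OF graph N]] graph by (simp add: simple_graph_def)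
qed

lemma sum_le_sum_if_card_eq:
  fixes f :: "'a \<Rightarrow> 'b :: ordered_comm_monoid_add"
  assumes "finite A" "finite B" "card A = card B"
    and pointwise_le: "\<And>a b. a \<in> A - B \<Longrightarrow> b \<in> B - A \<Longrightarrow> f a \<le> f b"
  shows "sum f A \<le> sum f B"
proof -
  have "card (A - B) = card (B - A)"
    using assms(1-3) by (simp add: card_Diff_subset_Int Int_commute)
  then obtain h where h: "bij_betw h (A - B) (B - A)"
    using finite_same_card_bij[of "A - B" "B - A"] assms(1,2) by auto
  then have "sum f (A - B) \<le> (\<Sum>a\<in>A - B. f (h a))"
    using pointwise_le by (intro sum_mono) (auto dest: bij_betwE)
  also have "\<dots> = sum f (B - A)" by (rule sum.reindex_bij_betw[OF h])
  finally have "sum f (A \<inter> B) + sum f (A - B) \<le> sum f (B \<inter> A) + sum f (B - A)"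
    by (simp add: Int_commute add_left_mono)
  then show ?thesis using assms(1,2) by (simp add: sum.Int_Diff[symmetric])
qed

lemma weighted_edges_inside_le:
  assumes graph: "simple_graph V E" and M: "matching E M" and N: "matching E N"
    and feasible: "dual_feasible V E w y" and U: "U \<in> odd_sets V"
    and near_perfect: "y U \<noteq> 0 \<Longrightarrow> near_perfect_inside M U"
  shows "y U * card (edges_inside N U) \<le> y U * card (edges_inside M U)"
proof (cases "3 \<le> card U \<and> y U \<noteq> 0")
  case True
  then have "card (edges_inside N U) \<le> card (edges_inside M U)"
    using card_edges_inside_le[OF graph N U] card_edges_inside_near_perfect[OF graph M U near_perfect]
    by simp
  moreover have "0 \<le> y U" using feasible U True by (auto simp: dual_feasible_def)
  ultimately show ?thesis by (intro mult_left_mono) auto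
next
  case False
  have "odd (card U)" using U by (auto simp: odd_sets_def)
  then have "3 \<le> card U \<or> card U = 1" by presburger
  then have "card U = 1 \<or> y U = 0" using False by blast
  then show ?thesis using card_edges_inside_le[OF graph N U] card_edges_inside_le[OF graph M U] by auto
qed

lemma cardinality_optimal_if_complementary_slackness:
  assumes graph: "simple_graph V E" and M: "matching E M" and feasible: "dual_feasible V E w y"
    and tight: "\<And>e. e \<in> M \<Longrightarrow> dual_load V E y e = w e"
    and near_perfect: "\<And>U. U \<in> odd_sets V \<Longrightarrow> y U \<noteq> 0 \<Longrightarrow> near_perfect_inside M U"
    and maximal: "exposed_potential_maximal V y M"
  shows "cardinality_optimal E w M"
  unfolding cardinality_optimal_def
proof (intro conjI allI impI)
  fix N assume "matching E N \<and> card N = card M"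
  then have N: "matching E N" "card N = card M" by auto
  have "(\<Sum>v\<in>\<Union> M. vertex_potential V y v) \<le> (\<Sum>v\<in>\<Union> N. vertex_potential V y v)"
  proof (rule sum_le_sum_if_card_eq)
    show "card (\<Union> M) = card (\<Union> N)" using card_matching_vertices[OF graph] M N by simp
    have subset: "\<Union> M \<subseteq> V" "\<Union> N \<subseteq> V" using matching_edge(2)[OF graph] M N by blast+
    then show "finite (\<Union> M)" "finite (\<Union> N)" using graph finite_subset unfolding simple_graph_def by metis+
    show "vertex_potential V y u \<le> vertex_potential V y v" if "u \<in> \<Union> M - \<Union> N" "v \<in> \<Union> N - \<Union> M" for u v
      using that subset maximal unfolding exposed_potential_maximal_def by blast
  qed
  moreover have "(\<Sum>U\<in>odd_sets V. y U * card (edges_inside N U)) \<le>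
                 (\<Sum>U\<in>odd_sets V. y U * card (edges_inside M U))"
    by (intro sum_mono weighted_edges_inside_le[OF graph M N(1) feasible] near_perfect)
  ultimately have "(\<Sum>e\<in>M. dual_load V E y e) \<le> (\<Sum>e\<in>N. dual_load V E y e)"
    using sum_dual_load_matching[OF graph M, of y] sum_dual_load_matching[OF graph N(1), of y] by linarith
  also have "\<dots> \<le> sum w N"
    using feasible matching_edge(1)[OF graph N(1)] by (intro sum_mono) (auto simp: dual_feasible_def)
  finally show "sum w M \<le> sum w N" using tight by simp
qed (rule M)

section \<open>Dual updates\<close>

locale node_supported_change =
  fixes V :: "'v set" and \<N> and x :: "'v set \<Rightarrow> real"
  assumes finite: "finite V" and nodes_odd: "\<N> \<subseteq> odd_sets V" and nodes_disjoint: "pairwise disjnt \<N>"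
    and supported: "U \<notin> \<N> \<Longrightarrow> x U = 0"
begin

lemma dual_above_eq_node:
  assumes "B \<in> \<N>" "A \<subseteq> B" "A \<noteq> {}"
  shows "dual_above V x A = x B"
proof -
  have "dual_above V x A = (\<Sum>U\<in>{B}. x U)"
    unfolding dual_above_def
  proof (rule sum.mono_neutral_right)
    show "finite {U. U \<in> odd_sets V \<and> A \<subseteq> U}" using finite_odd_sets[OF finite] by simp
    show "{B} \<subseteq> {U. U \<in> odd_sets V \<and> A \<subseteq> U}" using assms nodes_odd by auto
    have "U \<notin> \<N>" if "A \<subseteq> U" "U \<noteq> B" for U
      using nodes_disjoint assms that unfolding pairwise_def disjnt_def by blast
    then show "\<forall>U\<in>{U. U \<in> odd_sets V \<and> A \<subseteq> U} - {B}. x U = 0" using supported by blast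
  qed
  then show ?thesis by simp
qed

lemma dual_above_eq_0: "(\<And>B. B \<in> \<N> \<Longrightarrow> \<not> A \<subseteq> B) \<Longrightarrow> dual_above V x A = 0"
  unfolding dual_above_def using supported by (intro sum.neutral) blast

context
  fixes E a b
  assumes original_graph: "simple_graph V E" and e: "{a, b} \<in> E"
begin

lemma ends_distinct: "a \<noteq> b"
  using original_graph e by (auto simp: simple_graph_def)

lemma dual_load_inside_node:
  assumes "B \<in> \<N>" "{a, b} \<subseteq> B" shows "dual_load V E x {a, b} = 0"
proof -
  have "dual_above V x A = x B" if "A \<subseteq> {a, b}" "A \<noteq> {}" for A
    using assms(2) that by (intro dual_above_eq_node[OF assms(1)]) auto
  then show ?thesis using dual_load_eq_potentials[OF original_graph e, of x] ends_distinct by simp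
qed

lemma dual_load_between_nodes:
  assumes "A \<in> \<N>" "a \<in> A" "B \<in> \<N>" "b \<in> B" "A \<noteq> B"
  shows "dual_load V E x {a, b} = x A + x B"
proof -
  have "dual_above V x {a, b} = 0"
  proof (rule dual_above_eq_0)
    fix C assume "C \<in> \<N>"
    then show "\<not> {a, b} \<subseteq> C"
      using pairwiseD[OF nodes_disjoint] assms by (metis disjnt_iff insert_subset)
  qed
  moreover have "vertex_potential V x a = x A" "vertex_potential V x b = x B"
    using assms by (simp_all add: dual_above_eq_node)
  ultimately show ?thesis using dual_load_eq_potentials[OF original_graph e, of x] ends_distinct by simp
qed

end

end

locale dual_change = blossom_structure V T s for V :: "'v set" and T s +
  fixes y :: "'v set \<Rightarrow> real" and \<delta> :: real
  assumes \<delta>_nonneg: "0 \<le> \<delta>"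
    and change_even: "U \<in> contracted.even_reachable \<Longrightarrow> y U = dual s U + \<delta>"
    and change_odd: "U \<in> contracted.odd_reachable \<Longrightarrow> y U = dual s U - \<delta>"
    and change_other: "U \<notin> contracted.even_reachable \<Longrightarrow> U \<notin> contracted.odd_reachable \<Longrightarrow> y U = dual s U"
begin

lemma dual_eq_if_not_node: "U \<notin> nodes s \<Longrightarrow> y U = dual s U"
  using change_other contracted.reachable_subset_nodes by blast

sublocale change: node_supported_change V "nodes s" "\<lambda>U. y U - dual s U"
  by unfold_locales
    (use finite_V family_odd node_in_family contracted.nodes_disjoint dual_eq_if_not_node in auto)

lemma vertex_potential_change:
  "B \<in> nodes s \<Longrightarrow> v \<in> B \<Longrightarrow> vertex_potential V y v = vertex_potential V (dual s) v + (y B - dual s B)"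
  using change.dual_above_eq_node[of B "{v}"] by (simp add: dual_above_diff)

lemma vertex_potential_change_le:
  assumes "v \<in> V" shows "vertex_potential V y v \<le> vertex_potential V (dual s) v + \<delta>"
proof -
  obtain B where B: "B \<in> nodes s" "v \<in> B" using node_containing[OF assms] .
  then show ?thesis
    using vertex_potential_change[OF B] change_even[of B] change_odd[of B] change_other[of B] \<delta>_nonneg
    by force
qed

lemma vertex_potential_change_exposed:
  assumes "v \<in> V" "v \<notin> \<Union> (full_matching s)"
  shows "vertex_potential V y v = vertex_potential V (dual s) v + \<delta>"
proof -
  obtain B where B: "B \<in> nodes s" "v \<in> B" using node_containing[OF assms(1)] .
  then have "B \<in> contracted.even_reachable"
    using contracted.uncovered_even_reachable node_uncovered_if_vertex_uncovered assms(2) by blast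
  then show ?thesis using vertex_potential_change[OF B] change_even[of B] by simp
qed

lemma exposed_potential_maximal_change:
  assumes "exposed_potential_maximal V (dual s) (full_matching s)"
  shows "exposed_potential_maximal V y (full_matching s)"
  unfolding exposed_potential_maximal_def
proof (intro ballI)
  fix u v assume u: "u \<in> V" and v: "v \<in> V - \<Union> (full_matching s)"
  have "vertex_potential V y u \<le> vertex_potential V (dual s) u + \<delta>"
    by (rule vertex_potential_change_le[OF u])
  also have "\<dots> \<le> vertex_potential V (dual s) v + \<delta>"
    using assms u v unfolding exposed_potential_maximal_def by simp
  also have "\<dots> = vertex_potential V y v" using vertex_potential_change_exposed v by simp
  finally show "vertex_potential V y u \<le> vertex_potential V y v" .
qed

lemma change_matched_nodes:
  assumes "e \<in> cmatch s" "e \<inter> A \<noteq> {}" "e \<inter> B \<noteq> {}" "A \<in> nodes s" "B \<in> nodes s" "A \<noteq> B"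
  shows "(y A - dual s A) + (y B - dual s B) = 0"
proof -
  have "A \<in> contracted.even_reachable \<longleftrightarrow> B \<in> contracted.odd_reachable"
    "A \<in> contracted.odd_reachable \<longleftrightarrow> B \<in> contracted.even_reachable"
    using contracted.odd_reachable_if_matched_to_even_reachable
      contracted.even_reachable_if_matched_to_odd_reachable assms assms(6)[symmetric] by metis+
  then show ?thesis
    using change_even change_odd change_other by (smt (verit))
qed

context
  fixes E and e :: "'v set"
  assumes original_graph: "simple_graph V E" and e: "e \<in> E"
begin

lemma dual_load_eq_inside_node:
  assumes "B \<in> nodes s" "e \<subseteq> B"
  shows "dual_load V E y e = dual_load V E (dual s) e"
proof -
  obtain a b where "e = {a, b}" using original_graph e by (auto simp: simple_graph_def card_2_iff)
  then have "dual_load V E (\<lambda>U. y U - dual s U) e = 0"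
    using change.dual_load_inside_node[OF original_graph _ assms(1)] e assms(2) by simp
  then show ?thesis by (simp add: dual_load_diff)
qed

lemma dual_load_eq_cmatch:
  assumes "e \<in> cmatch s"
  shows "dual_load V E y e = dual_load V E (dual s) e"
proof -
  obtain a b where e_eq: "e = {a, b}" using original_graph e by (auto simp: simple_graph_def card_2_iff)
  have "e \<subseteq> V" using original_graph e by (simp add: simple_graph_def)
  then obtain A B where A: "A \<in> nodes s" "a \<in> A" and B: "B \<in> nodes s" "b \<in> B"
    using node_containing e_eq by (metis insert_subset)
  have "A \<noteq> B" using contracted.matched_not_inside[OF A(1) assms] A(2) B(2) e_eq by blast
  then have "dual_load V E (\<lambda>U. y U - dual s U) e = (y A - dual s A) + (y B - dual s B)"
    using change.dual_load_between_nodes[OF original_graph _ A B] e e_eq by simp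
  also have "\<dots> = 0"
    using change_matched_nodes[OF assms _ _ A(1) B(1) \<open>A \<noteq> B\<close>] A(2) B(2) e_eq by simp
  finally show ?thesis by (simp add: dual_load_diff)
qed

end

end

section \<open>The invariants of the algorithm\<close>

locale edmonds_state = blossom_structure V "tight_edges V E w s" s
  for V :: "'v set" and E w s +
  assumes original_graph: "simple_graph V E"
    and dual_support: "U \<notin> family s \<Longrightarrow> dual s U = 0"
    and feasible: "dual_feasible V E w (dual s)"

lemma tight_edges_cong: "dual s' = dual s \<Longrightarrow> tight_edges V E w s' = tight_edges V E w s"
  by (simp add: tight_edges_def)

lemma simple_graph_tight_edges: "simple_graph V E \<Longrightarrow> simple_graph V (tight_edges V E w s)"
  by (simp add: simple_graph_def tight_edges_def)

lemma exposed_potential_maximal_mono: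
  "\<Union> M \<subseteq> \<Union> M' \<Longrightarrow> exposed_potential_maximal V y M \<Longrightarrow> exposed_potential_maximal V y M'"
  unfolding exposed_potential_maximal_def by blast

lemma edmonds_state_init:
  assumes graph: "simple_graph V E" and init: "edmonds_init V E w s"
  shows "edmonds_state V E w s"
proof -
  have family: "family s = (\<lambda>v. {v}) ` V" and unmatched: "cmatch s = {}"
    using init by (auto simp: edmonds_init_def)
  have no_blossoms: "blossoms s = {}" by (auto simp: blossoms_def family)
  show ?thesis
  proof
    show "family s \<subseteq> odd_sets V" by (auto simp: family odd_sets_def)
    show "A \<subseteq> B \<or> B \<subseteq> A" if "A \<in> family s" "B \<in> family s" "A \<inter> B \<noteq> {}" for A B
      using that by (auto simp: family)
    show "node_matching (nodes s) (tight_edges V E w s) (cmatch s)"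
      by (simp add: unmatched node_matching_def incident_def)
  qed (use graph simple_graph_tight_edges[OF graph] init in \<open>auto simp: edmonds_init_def no_blossoms\<close>)
qed

lemma exposed_potential_maximal_init:
  assumes graph: "simple_graph V E" and init: "edmonds_init V E w s" and equal: "\<forall>v\<in>V. dual s {v} = \<beta>"
  shows "exposed_potential_maximal V (dual s) M"
proof -
  interpret node_supported_change V "(\<lambda>v. {v}) ` V" "dual s"
    by unfold_locales
      (use graph init in \<open>auto simp: simple_graph_def edmonds_init_def odd_sets_def pairwise_def\<close>)
  have "vertex_potential V (dual s) v = \<beta>" if "v \<in> V" for v
    using that equal dual_above_eq_node[of "{v}" "{v}"] by simp
  then show ?thesis by (simp add: exposed_potential_maximal_def)
qed

context edmonds_state
begin

lemma cardinality_optimal_full_matching: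
  assumes "exposed_potential_maximal V (dual s) (full_matching s)"
  shows "cardinality_optimal E w (full_matching s)"
proof (rule cardinality_optimal_if_complementary_slackness[OF original_graph _ feasible _ _ assms])
  show "matching E (full_matching s)"
    using matching_full_matching by (auto simp: matching_def tight_edges_def)
  show "dual_load V E (dual s) e = w e" if "e \<in> full_matching s" for e
    using that full_matching_subset by (auto simp: tight_edges_def)
  show "near_perfect_inside (full_matching s) U" if "dual s U \<noteq> 0" for U
    using that dual_support near_perfect_inside_member by blast
qed

lemma exposed_walk_iff:
  "exposed_walk V E w s Us es \<longleftrightarrow>
     contracted.rooted_walk Us es \<and> es \<noteq> [] \<and> uncovered (cmatch s) (last Us)"
  using walk_hd_in walk_last_in
  unfolding exposed_walk_def alt_walk_def exposed_nodes_def contracted.rooted_walk_def by blast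

lemma alt_walk_from_exposed_iff:
  "alt_walk V E w s Us es \<and> hd Us \<in> exposed_nodes s \<longleftrightarrow> contracted.rooted_walk Us es"
  using walk_hd_in unfolding alt_walk_def exposed_nodes_def contracted.rooted_walk_def by blast

lemma outer_nodes_eq: "outer_nodes V E w s = contracted.even_reachable"
  unfolding outer_nodes_def contracted.even_reachable_def alt_walk_from_exposed_iff[symmetric] by blast

lemma inner_nodes_eq: "inner_nodes V E w s = contracted.odd_reachable"
  unfolding inner_nodes_def contracted.odd_reachable_def alt_walk_from_exposed_iff[symmetric] by blast

lemma exposed_nodes_subset_outer: "exposed_nodes s \<subseteq> outer_nodes V E w s"
  using contracted.uncovered_even_reachable by (auto simp: outer_nodes_eq exposed_nodes_def)

lemma edmonds_state_if_dual_eq: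
  assumes "blossom_structure V (tight_edges V E w s) s'" "dual s' = dual s" "family s \<subseteq> family s'"
  shows "edmonds_state V E w s'"
proof -
  interpret new: blossom_structure V "tight_edges V E w s'" s'
    using assms(1) tight_edges_cong[OF assms(2)] by simp
  show ?thesis
    by unfold_locales (use assms(2,3) original_graph dual_support feasible in auto)
qed

lemma augment_step_augmentation:
  assumes "augment_step V E w s s'"
  obtains Us es N where "augmentation V (tight_edges V E w s) s Us es N s'"
proof -
  obtain Us es N where walk: "shortest_exposed_walk V E w s Us es" and distinct: "distinct Us"
    and s': "s' = s\<lparr>cmatch := sym_diff (cmatch s) (set es), near := N\<rparr>"
    and switched: "\<forall>U. U \<in> blossoms s \<and> (\<exists>B\<in>set Us. U \<subseteq> B) \<longrightarrow>
             (\<exists>Q. even_cycle_path s U Q \<and> N U = sym_diff (near s U) Q)"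
    and unchanged: "\<forall>U. \<not> (U \<in> blossoms s \<and> (\<exists>B\<in>set Us. U \<subseteq> B)) \<longrightarrow> N U = near s U"
    and base: "\<forall>U\<in>blossoms s. \<forall>e \<in> full_matching s' \<inter> cut E U. \<forall>W\<in>cycle_nodes s U.
             e \<inter> W \<noteq> {} \<longrightarrow> uncovered (N U) W"
    using assms unfolding augment_step_def by (elim exE conjE) (rule that)
  have rooted: "contracted.rooted_walk Us es" "es \<noteq> []" "uncovered (cmatch s) (last Us)"
    using walk by (simp_all add: shortest_exposed_walk_def exposed_walk_iff)
  have tight_cut: "e \<in> cut E U" if "e \<in> cut (tight_edges V E w s) U" for e U
    using that by (simp add: cut_def tight_edges_def)
  have "augmentation V (tight_edges V E w s) s Us es N s'"
  proof
    show "uncovered (N U) W" if "U \<in> blossoms s" "e \<in> full_matching s' \<inter> cut (tight_edges V E w s) U"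
      "W \<in> cycle_nodes s U" "e \<inter> W \<noteq> {}" for U e W
      using base tight_cut that by blast
  qed (use rooted distinct s' switched unchanged in simp_all)
  then show thesis by (rule that)
qed

lemma augment_step_preserves:
  assumes "augment_step V E w s s'"
  shows "edmonds_state V E w s'" "dual s' = dual s" "\<Union> (full_matching s) \<subseteq> \<Union> (full_matching s')"
proof -
  obtain Us es N where "augmentation V (tight_edges V E w s) s Us es N s'"
    using augment_step_augmentation[OF assms] .
  then interpret augmentation V "tight_edges V E w s" s Us es N s' .
  show dual: "dual s' = dual s" by (simp add: augmented_state)
  show "edmonds_state V E w s'"
    by (rule edmonds_state_if_dual_eq[OF blossom_structure_augmented dual]) (simp add: augmented_simps)
  show "\<Union> (full_matching s) \<subseteq> \<Union> (full_matching s')" by (rule covered_vertices_augmented)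
qed

lemma shrink_step_shrinking:
  assumes "shrink_step V E w s s'"
  obtains Us es i j U where "shrinking V (tight_edges V E w s) s Us es i j U s'"
proof -
  obtain Us es i j where walk: "shortest_exposed_walk V E w s Us es"
    and segment: "i < j" "j < length Us" "Us ! i = Us ! j" "odd (j - i)"
    and distinct: "distinct (take (j - i) (drop i Us))"
    and s': "let U = \<Union> (set (take (j - i) (drop i Us))); C = set (take (j - i) (drop i es))
         in s' = s\<lparr>family := insert U (family s), dual := (dual s)(U := 0),
                  cmatch := cmatch s - C,
                  cycle := (cycle s)(U := C), near := (near s)(U := cmatch s \<inter> C)\<rparr>"
    using assms unfolding shrink_step_def by (elim exE conjE) (rule that)
  have rooted: "contracted.rooted_walk Us es"
    using walk by (simp add: shortest_exposed_walk_def exposed_walk_iff)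
  have length: "j \<le> length es"
    using segment(2) walk_length[OF contracted.rooted_walk_walk[OF rooted]] by simp
  have slice: "take (j - i) (drop i xs) = map ((!) xs) [i..<j]" if "j \<le> length xs" for xs :: "'v set list"
    using that by (intro nth_equalityI) auto
  interpret blossom: blossom_walk "nodes s" "tight_edges V E w s" "cmatch s" Us es i j
    by unfold_locales (use rooted length segment distinct in \<open>simp_all add: slice distinct_map\<close>)
  have "shrinking V (tight_edges V E w s) s Us es i j (\<Union> blossom.blossom_nodes) s'"
    by unfold_locales
      (use s' length segment(2) in
        \<open>simp_all add: slice Let_def blossom.blossom_nodes_def blossom.blossom_edges_def\<close>)
  then show thesis by (rule that)
qed

lemma shrink_step_preserves:
  assumes "shrink_step V E w s s'"
  shows "edmonds_state V E w s'" "dual s' = dual s" "full_matching s' = full_matching s"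
proof -
  obtain Us es i j U where "shrinking V (tight_edges V E w s) s Us es i j U s'"
    using shrink_step_shrinking[OF assms] .
  then interpret shrinking V "tight_edges V E w s" s Us es i j U s' .
  show dual: "dual s' = dual s"
    using dual_support[OF U_not_in_family] by (simp add: shrunk_simps fun_upd_idem)
  show "edmonds_state V E w s'"
    by (rule edmonds_state_if_dual_eq[OF blossom_structure_shrunk dual]) (auto simp: shrunk_simps)
  show "full_matching s' = full_matching s" by (rule full_matching_shrunk)
qed

lemma alternating_trees_root:
  assumes "alternating_trees V E w s r" "U \<in> outer_nodes V E w s \<union> inner_nodes V E w s"
  shows "r U \<in> exposed_nodes s" "r (r U) = r U"
proof -
  obtain Us es where path: "alt_walk V E w s Us es" "hd Us = r U" "\<forall>W\<in>set Us. r W = r U"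
    and root: "r U \<in> exposed_nodes s"
    using assms unfolding alternating_trees_def by meson
  have "Us \<noteq> []" using path(1) walk_length by (force simp: alt_walk_def)
  then show "r (r U) = r U" using path(2,3) hd_in_set by metis
  show "r U \<in> exposed_nodes s" by (rule root)
qed

lemma dual_change_shifted:
  assumes stuck: "\<nexists>Us es. exposed_walk V E w s Us es" and trees: "alternating_trees V E w s r"
    and y: "y = shifted_dual V E w s (\<lambda>U. a (r U))" and nonneg: "0 \<le> \<delta>"
    and uniform: "\<forall>U\<in>outer_nodes V E w s. y U = dual s U + \<delta>"
  shows "dual_change V (tight_edges V E w s) s y \<delta>"
proof
  have disjoint: "outer_nodes V E w s \<inter> inner_nodes V E w s = {}"
    unfolding outer_nodes_eq inner_nodes_eq
    using stuck by (intro contracted.even_odd_reachable_disjoint) (auto simp: exposed_walk_iff)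
  have amount: "a (r U) = \<delta>" if "U \<in> outer_nodes V E w s \<union> inner_nodes V E w s" for U
  proof -
    note root = alternating_trees_root[OF trees that]
    have "r U \<in> outer_nodes V E w s" using root(1) exposed_nodes_subset_outer by blast
    then show ?thesis using uniform root(2) by (auto simp: y shifted_dual_def)
  qed
  fix U
  show "y U = dual s U + \<delta>" if "U \<in> contracted.even_reachable"
    using that uniform by (simp add: outer_nodes_eq)
  show "y U = dual s U - \<delta>" if "U \<in> contracted.odd_reachable"
    using that amount[of U] disjoint by (auto simp: y shifted_dual_def inner_nodes_eq)
  show "y U = dual s U" if "U \<notin> contracted.even_reachable" "U \<notin> contracted.odd_reachable"
    using that by (simp add: y shifted_dual_def outer_nodes_eq inner_nodes_eq)
qed (rule nonneg)

lemma dual_step_dual_change: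
  assumes step: "dual_step V E w s s'"
    and uniform: "\<forall>U\<in>outer_nodes V E w s. dual s' U = dual s U + \<delta>"
  obtains y D where "dual_change V (tight_edges V E w s) s y \<delta>" "dual_feasible V E w y"
    "D = {U \<in> nodes s. 3 \<le> card U \<and> y U = 0}"
    "s' = s\<lparr>family := family s - D, dual := y, cmatch := cmatch s \<union> \<Union> (near s ` D)\<rparr>"
proof -
  obtain r d \<alpha> where stuck: "\<nexists>Us es. exposed_walk V E w s Us es" and trees: "alternating_trees V E w s r"
    and d: "\<forall>x\<in>exposed_nodes s. 0 \<le> d x" "\<exists>x\<in>exposed_nodes s. 0 < d x" "0 \<le> \<alpha>"
    and feasible_shift: "dual_feasible V E w (shifted_dual V E w s (\<lambda>U. \<alpha> * d (r U)))"
    and s'_let: "let y = shifted_dual V E w s (\<lambda>U. \<alpha> * d (r U)); D = {U \<in> nodes s. 3 \<le> card U \<and> y U = 0}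
         in s' = s\<lparr>family := family s - D, dual := y, cmatch := cmatch s \<union> \<Union> (near s ` D)\<rparr>"
    using step unfolding dual_step_def by (elim exE conjE) (rule that)
  define y where "y = shifted_dual V E w s (\<lambda>U. \<alpha> * d (r U))"
  define D where "D = {U \<in> nodes s. 3 \<le> card U \<and> y U = 0}"
  have s': "s' = s\<lparr>family := family s - D, dual := y, cmatch := cmatch s \<union> \<Union> (near s ` D)\<rparr>"
    using s'_let by (simp add: Let_def y_def D_def)
  have uniform_y: "\<forall>U\<in>outer_nodes V E w s. y U = dual s U + \<delta>" using uniform by (simp add: s')
  obtain x where "x \<in> exposed_nodes s" using d(2) by blast
  then have x: "x \<in> outer_nodes V E w s" using exposed_nodes_subset_outer by blast
  then have "\<delta> = \<alpha> * d (r x)" using uniform_y by (simp add: y_def shifted_dual_def)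
  moreover have "r x \<in> exposed_nodes s" using alternating_trees_root(1)[OF trees] x by blast
  ultimately have "0 \<le> \<delta>" using d(1,3) by simp
  then have "dual_change V (tight_edges V E w s) s y \<delta>"
    using dual_change_shifted[where a = "\<lambda>x. \<alpha> * d x", OF stuck trees y_def] uniform_y by blast
  then show thesis using that[OF _ _ D_def s'] feasible_shift by (simp add: y_def)
qed

lemma blossom_structure_dual_change:
  assumes "dual_change V (tight_edges V E w s) s y \<delta>" and dual_s': "dual s' = y"
  shows "blossom_structure V (tight_edges V E w s') s"
proof (rule blossom_structure_change_edges[OF simple_graph_tight_edges[OF original_graph]])
  interpret dual_change V "tight_edges V E w s" s y \<delta> by (rule assms(1))
  have still_tight: "e \<in> tight_edges V E w s'"
    if "e \<in> tight_edges V E w s" "dual_load V E y e = dual_load V E (dual s) e" for e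
    using that by (simp add: tight_edges_def dual_s')
  have in_E: "e \<in> E" if "e \<in> tight_edges V E w s" for e using that by (simp add: tight_edges_def)
  show "cmatch s \<subseteq> tight_edges V E w s'"
  proof
    fix e assume e: "e \<in> cmatch s"
    then have "e \<in> tight_edges V E w s" using node_matching_subset[OF cmatch_node_matching] by blast
    then show "e \<in> tight_edges V E w s'"
      using still_tight dual_load_eq_cmatch[OF original_graph in_E e] by simp
  qed
  show "cycle s U \<subseteq> tight_edges V E w s'" if U: "U \<in> blossoms s" for U
  proof
    fix e assume "e \<in> cycle s U"
    then have e: "e \<in> tight_edges V E w s" "e \<subseteq> U" using cycle_inside[OF U] by (auto simp: edges_inside_def)
    obtain B where B: "B \<in> nodes s" "U \<subseteq> B"
      using maximal_superset[OF family.finite blossom_in_family[OF U]] unfolding nodes_def .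
    then have "e \<subseteq> B" using e(2) by blast
    then show "e \<in> tight_edges V E w s'"
      using still_tight[OF e(1)] dual_load_eq_inside_node[OF original_graph in_E[OF e(1)] B(1)] by simp
  qed
qed

lemma dual_step_preserves:
  assumes step: "dual_step V E w s s'"
    and uniform: "\<forall>U\<in>outer_nodes V E w s. dual s' U = dual s U + \<delta>"
    and maximal: "exposed_potential_maximal V (dual s) (full_matching s)"
  shows "edmonds_state V E w s'" "exposed_potential_maximal V (dual s') (full_matching s')"
proof -
  obtain y D where change: "dual_change V (tight_edges V E w s) s y \<delta>"
    and feasible_y: "dual_feasible V E w y"
    and D: "D = {U \<in> nodes s. 3 \<le> card U \<and> y U = 0}"
    and s': "s' = s\<lparr>family := family s - D, dual := y, cmatch := cmatch s \<union> \<Union> (near s ` D)\<rparr>"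
    using dual_step_dual_change[OF step uniform] .
  interpret dual_change V "tight_edges V E w s" s y \<delta> by (rule change)
  have dual_s': "dual s' = y" by (simp add: s')
  have "blossom_structure V (tight_edges V E w s') s"
    by (rule blossom_structure_dual_change[OF change dual_s'])
  then interpret deshrink: deshrinking V "tight_edges V E w s'" s D y s'
    by (intro deshrinking.intro deshrinking_axioms.intro)
      (use D s' node_in_family in \<open>auto simp: blossoms_def\<close>)
  interpret deshrunk: blossom_structure V "tight_edges V E w s'" s'
    by (rule deshrink.blossom_structure_deshrunk)
  show "edmonds_state V E w s'"
  proof
    fix U assume U: "U \<notin> family s'"
    show "dual s' U = 0"
    proof (cases "U \<in> D")
      case False
      then have "U \<notin> family s" using U by (simp add: deshrink.deshrunk_simps)
      then show ?thesis using dual_support dual_eq_if_not_node node_in_family by (metis dual_s')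
    qed (simp add: D dual_s')
  qed (simp_all add: original_graph dual_s' feasible_y)
  show "exposed_potential_maximal V (dual s') (full_matching s')"
    using exposed_potential_maximal_change[OF maximal] by (simp add: dual_s' deshrink.full_matching_deshrunk)
qed

lemma edmonds_iteration_preserves:
  assumes iteration: "edmonds_iteration V E w s s'"
    and uniform: "dual_step V E w s s' \<Longrightarrow> \<exists>\<delta>. \<forall>U\<in>outer_nodes V E w s. dual s' U = dual s U + \<delta>"
    and maximal: "exposed_potential_maximal V (dual s) (full_matching s)"
  shows "edmonds_state V E w s' \<and> exposed_potential_maximal V (dual s') (full_matching s')"
proof -
  consider (augment) "augment_step V E w s s'" | (shrink) "shrink_step V E w s s'"
    | (dual) "dual_step V E w s s'"
    using iteration unfolding edmonds_iteration_def by blast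
  then show ?thesis
  proof cases
    case augment
    then show ?thesis
      using augment_step_preserves[OF augment] exposed_potential_maximal_mono maximal by metis
  next
    case shrink
    then show ?thesis using shrink_step_preserves[OF shrink] maximal by simp
  next
    case dual
    then obtain \<delta> where "\<forall>U\<in>outer_nodes V E w s. dual s' U = dual s U + \<delta>" using uniform by blast
    then show ?thesis using dual_step_preserves[OF dual _ maximal] by blast
  qed
qed

end

theorem theorem7:
  fixes V :: "'v set" and E :: "'v set set" and w :: "'v set \<Rightarrow> real"
    and s :: "nat \<Rightarrow> 'v state" and n :: nat and \<beta> :: real
  assumes "simple_graph V E"
    and "\<forall>e\<in>E. 0 \<le> w e"
    and "edmonds_run V E w s n"
    and "\<forall>U\<in>odd_sets V. 3 \<le> card U \<longrightarrow> dual (s 0) U = 0"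
    and "\<forall>v\<in>V. dual (s 0) {v} = \<beta>"
    and "\<forall>i<n. dual_step V E w (s i) (s (Suc i)) \<longrightarrow>
           (\<exists>\<delta>. \<forall>U\<in>outer_nodes V E w (s i). dual (s (Suc i)) U = dual (s i) U + \<delta>)"
  shows "\<forall>i\<le>n. cardinality_optimal E w (full_matching (s i))"
proof -
  have init: "edmonds_init V E w (s 0)"
    and iterations: "\<And>i. i < n \<Longrightarrow> edmonds_iteration V E w (s i) (s (Suc i))"
    using assms(3) by (auto simp: edmonds_run_def)
  have "edmonds_state V E w (s i) \<and> exposed_potential_maximal V (dual (s i)) (full_matching (s i))"
    if "i \<le> n" for i
    using that
  proof (induction i)
    case 0
    show ?case
      using edmonds_state_init[OF assms(1) init]
        exposed_potential_maximal_init[OF assms(1) init assms(5)] ..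
  next
    case (Suc i)
    then show ?case using edmonds_state.edmonds_iteration_preserves[OF _ iterations] assms(6) by simp
  qed
  then show ?thesis using edmonds_state.cardinality_optimal_full_matching by blast
qed

end
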